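(* Let $F$ be an algebraically closed field of characteristic $0$, let $A$ be a classical Lie superalgebra over $F$, let $\delta\in F$, and let $\phi: A\to A$ be a nontrivial $\delta$-derivation of $A$. Then $\delta=\frac{1}{2}$ and there exists $\alpha\in F$ such that $\phi(x)=\alpha x$ for all $x\in A$.
   Context: A Lie superalgebra over $F$ is a $\mathbb{Z}_2$-graded algebra $G=G_0+G_1$ with product $[\cdot,\cdot]$ (also written $xy$) satisfying, for homogeneous $x,y,z$, $[x,y]=-(-1)^{p(x)p(y)}[y,x]$ and $[[x,y],z]-[x,[y,z]]-(-1)^{p(x)p(z)}\cdots$ in the usual sense, i.e. super-anticommutativity and the super Jacobi identity, where $p(x)=i$ if $x\in G_i$. A finite-dimensional Lie superalgebra $G=G_0+G_1$ with $G_1\neq 0$ is called classical if $G$ is simple and the representation of $G_0$ on $G_1$ is completely reducible. For $\delta\in F$, a $\delta$-derivation of a superalgebra $A$ is an $F$-linear map $\phi:A\to A$ (not assumed homogeneous) such that $\phi(xy)=\delta(x\phi(y)+\phi(x)y)$ for all $x,y\in A$ (no sign factors). In particular a $1$-derivation is an ordinary derivation and a $0$-derivation is a linear map with $\phi(A^2)=0$. A nontrivial $\delta$-derivation is a nonzero $\delta$-derivation that is neither a $1$-derivation nor a $0$-derivation. *)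

theory Defs
  imports "HOL-Library.Z2" "HOL-Computational_Algebra.Polynomial"
begin

text \<open>
  The underlying space of an algebra is a whole type. The grading is by the field \<^typ>\<open>bit\<close>
  of integers modulo 2, so that the degree of a product is a sum in \<^typ>\<open>bit\<close>.
\<close>

locale superalgebra = vector_space scale
  for scale :: "'f::field \<Rightarrow> 'a::ab_group_add \<Rightarrow> 'a" +
  fixes G :: "bit \<Rightarrow> 'a set"
    and mul :: "'a \<Rightarrow> 'a \<Rightarrow> 'a"
  assumes mul_linear_right: "\<And>x. Vector_Spaces.linear scale scale (\<lambda>y. mul x y)"
    and mul_linear_left: "\<And>y. Vector_Spaces.linear scale scale (\<lambda>x. mul x y)"
    and subspace_grade: "\<And>i. subspace (G i)"
    and grade_span: "\<And>x. \<exists>x0\<in>G 0. \<exists>x1\<in>G 1. x = x0 + x1"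
    and grade_disjoint: "G 0 \<inter> G 1 = {0}"
    and mul_grade: "\<And>i j x y. x \<in> G i \<Longrightarrow> y \<in> G j \<Longrightarrow> mul x y \<in> G (i + j)"
begin

definition graded_subspace :: "'a set \<Rightarrow> bool" where
  "graded_subspace I \<longleftrightarrow>
     subspace I \<and> (\<forall>x\<in>I. \<exists>x0\<in>I \<inter> G 0. \<exists>x1\<in>I \<inter> G 1. x = x0 + x1)"

definition graded_ideal :: "'a set \<Rightarrow> bool" where
  "graded_ideal I \<longleftrightarrow>
     graded_subspace I \<and> (\<forall>x. \<forall>y\<in>I. mul x y \<in> I \<and> mul y x \<in> I)"

text \<open>
  As usual for superalgebras, simplicity refers to graded ideals. For Lie superalgebras in
  characteristic other than 2 this also excludes proper nonzero ideals that are not graded.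
\<close>

definition simple :: bool where
  "simple \<longleftrightarrow>
     (\<exists>x y. mul x y \<noteq> 0) \<and> (\<forall>I. graded_ideal I \<longrightarrow> I = {0} \<or> I = UNIV)"

end

text \<open>The sign $(-1)^{ij}$.\<close>

definition super_sign :: "bit \<Rightarrow> bit \<Rightarrow> 'f::field" where
  "super_sign i j = (if i = 1 \<and> j = 1 then - 1 else 1)"

locale lie_superalgebra = superalgebra scale G mul
  for scale :: "'f::field \<Rightarrow> 'a::ab_group_add \<Rightarrow> 'a"
    and G :: "bit \<Rightarrow> 'a set"
    and mul :: "'a \<Rightarrow> 'a \<Rightarrow> 'a" +
  assumes super_anticomm:
      "\<And>i j x y. x \<in> G i \<Longrightarrow> y \<in> G j \<Longrightarrow>
         mul x y = - scale (super_sign i j) (mul y x)"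
    and super_jacobi:
      "\<And>i j k x y z. x \<in> G i \<Longrightarrow> y \<in> G j \<Longrightarrow> z \<in> G k \<Longrightarrow>
         mul x (mul y z) =
           mul (mul x y) z + scale (super_sign i j) (mul y (mul x z))"
begin

definition G0_submodule :: "'a set \<Rightarrow> bool" where
  "G0_submodule V \<longleftrightarrow>
     subspace V \<and> V \<subseteq> G 1 \<and> (\<forall>g\<in>G 0. \<forall>v\<in>V. mul g v \<in> V)"

text \<open>Every submodule of the $G_0$-module $G_1$ has a complementary submodule.\<close>

definition G1_completely_reducible :: bool where
  "G1_completely_reducible \<longleftrightarrow>
     (\<forall>V. G0_submodule V \<longrightarrow>
        (\<exists>W. G0_submodule W \<and> V \<inter> W = {0} \<and> (\<forall>x\<in>G 1. \<exists>v\<in>V. \<exists>w\<in>W. x = v + w)))"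

end

locale classical_lie_superalgebra = lie_superalgebra scale G mul
  for scale :: "'f::field \<Rightarrow> 'a::ab_group_add \<Rightarrow> 'a"
    and G :: "bit \<Rightarrow> 'a set"
    and mul :: "'a \<Rightarrow> 'a \<Rightarrow> 'a" +
  assumes finite_dimensional: "\<exists>B. finite B \<and> span B = UNIV"
    and odd_part_nonzero: "G 1 \<noteq> {0}"
    and is_simple: "simple"
    and completely_reducible: "G1_completely_reducible"

text \<open>
  The map is neither required to preserve degrees nor is there a sign in the product rule.
\<close>

definition delta_derivation ::
    "('f::field \<Rightarrow> 'a::ab_group_add \<Rightarrow> 'a) \<Rightarrow> ('a \<Rightarrow> 'a \<Rightarrow> 'a) \<Rightarrow> 'f \<Rightarrow> ('a \<Rightarrow> 'a) \<Rightarrow> bool"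
  where
  "delta_derivation scale mul \<delta> \<phi> \<longleftrightarrow>
     Vector_Spaces.linear scale scale \<phi> \<and>
     (\<forall>x y. \<phi> (mul x y) = scale \<delta> (mul x (\<phi> y) + mul (\<phi> x) y))"

definition nontrivial_delta_derivation ::
    "('f::field \<Rightarrow> 'a::ab_group_add \<Rightarrow> 'a) \<Rightarrow> ('a \<Rightarrow> 'a \<Rightarrow> 'a) \<Rightarrow> 'f \<Rightarrow> ('a \<Rightarrow> 'a) \<Rightarrow> bool"
  where
  "nontrivial_delta_derivation scale mul \<delta> \<phi> \<longleftrightarrow>
     delta_derivation scale mul \<delta> \<phi> \<and> \<phi> \<noteq> (\<lambda>x. 0) \<and>
     \<not> delta_derivation scale mul 1 \<phi> \<and> \<not> delta_derivation scale mul 0 \<phi>"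

end

theory Submission
  imports Defs
begin

text \<open>
  Let \<open>\<phi>\<close> be a \<open>\<delta>\<close>-derivation with \<open>\<delta> \<noteq> 0, 1\<close>. The two components of \<open>\<phi>\<close> that preserve and
  reverse the parity are again \<open>\<delta>\<close>-derivations. For the reversing component the product rule
  without signs conflicts with super-anticommutativity so strongly that the image \<open>V\<close> of the odd
  part is an ideal of the even part with \<open>[V, [V, G\<^sub>1]] = 0\<close>; complete reducibility of \<open>G\<^sub>1\<close> leaves
  only \<open>V = 0\<close> (\<open>odd_delta_derivation_zero\<close>).

  The parity-preserving component obeys the product rule with signs as well. Maps that do so, of
  either parity, form a module over the whole superalgebra: the supercommutator with a
  multiplication operator is again such a map. For odd \<open>x\<close> let \<open>X\<close> and \<open>Y\<close> be the left
  multiplications by \<open>x\<close> and \<open>\<phi> x\<close>. Evaluating \<open>\<phi>\<close> on \<open>[[x, x], v] = 2 X\<^sup>2 v\<close> in two ways gives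
  \<open>X\<^sup>2 \<phi> = Y X\<close>, and consequences of this identity are that \<open>X\<^sup>4 \<phi> = 0\<close> if \<open>\<delta> \<noteq> 1/2\<close>, and that
  \<open>X\<^sup>4 [Z, \<phi>] = 0\<close> for the multiplication \<open>Z\<close> by any odd element if \<open>\<delta> = 1/2\<close>
  (\<open>fourth_power_kills_image\<close>, \<open>fourth_power_kills_supercommutator\<close>). The images of all the maps
  \<open>\<phi>\<close>, respectively of all the \<open>[Z, \<phi>]\<close>, span a graded ideal. If one of these maps were nonzero,
  then by simplicity \<open>X\<^sup>4 = 0\<close> for every odd \<open>x\<close> (\<open>fourth_power_vanishes\<close>).

  That is impossible (\<open>exists_odd_fourth_power\<close>). It would say that every \<open>c = [x, x]\<close> satisfies
  \<open>[c, [c, v]] = 0\<close> for all \<open>v\<close>. The even elements \<open>c\<close> with this property are closed under the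
  bracket, and they would span \<open>G\<^sub>0\<close>, so by an Engel-Jacobson argument \<open>G\<^sub>0\<close> would act nilpotently,
  contrary to \<open>[G\<^sub>0, G\<^sub>1] = G\<^sub>1\<close>.

  Hence \<open>\<phi> = 0\<close> if \<open>\<delta> \<noteq> 1/2\<close>, while for \<open>\<delta> = 1/2\<close> the map commutes with all multiplications by odd
  elements. Then any of its eigenspaces is a graded ideal, and \<open>\<phi>\<close> is a scalar, as in the lemma of
  Schur.
\<close>

section \<open>Superalgebras and their graded ideals\<close>

lemma bit_add_self [simp]: "i + i = (0::bit)"
  by (cases i) simp_all

context superalgebra
begin

lemma
  shows mul_add_right: "mul x (y + z) = mul x y + mul x z"
    and mul_add_left: "mul (x + y) z = mul x z + mul y z"
    and mul_scale_right: "mul x (scale c y) = scale c (mul x y)"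
    and mul_scale_left: "mul (scale c x) y = scale c (mul x y)"
    and mul_zero_right: "mul x 0 = 0"
    and mul_zero_left: "mul 0 x = 0"
    and mul_minus_right: "mul x (- y) = - mul x y"
    and mul_minus_left: "mul (- x) y = - mul x y"
    and mul_diff_right: "mul x (y - z) = mul x y - mul x z"
    and mul_diff_left: "mul (x - y) z = mul x z - mul y z"
proof -
  interpret R: Vector_Spaces.linear scale scale "\<lambda>y. mul x y" for x by (rule mul_linear_right)
  interpret L: Vector_Spaces.linear scale scale "\<lambda>x. mul x y" for y by (rule mul_linear_left)
  show "mul x (y + z) = mul x y + mul x z" "mul (x + y) z = mul x z + mul y z"
    "mul x (scale c y) = scale c (mul x y)" "mul (scale c x) y = scale c (mul x y)"
    "mul x 0 = 0" "mul 0 x = 0" "mul x (- y) = - mul x y" "mul (- x) y = - mul x y"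
    "mul x (y - z) = mul x y - mul x z" "mul (x - y) z = mul x z - mul y z"
    by (rule R.add L.add R.scale L.scale R.zero L.zero R.neg L.neg R.diff L.diff)+
qed

lemmas mul_simps = mul_add_right mul_add_left mul_scale_right mul_scale_left mul_zero_right
  mul_zero_left mul_minus_right mul_minus_left mul_diff_right mul_diff_left

lemmas module_simps = scale_right_distrib scale_left_distrib scale_right_diff_distrib
  scale_left_diff_distrib

lemma grade_closed:
  shows "0 \<in> G i" and "x \<in> G i \<Longrightarrow> y \<in> G i \<Longrightarrow> x + y \<in> G i"
    and "x \<in> G i \<Longrightarrow> y \<in> G i \<Longrightarrow> x - y \<in> G i"
    and "x \<in> G i \<Longrightarrow> scale c x \<in> G i" and "x \<in> G i \<Longrightarrow> - x \<in> G i"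
  using subspace_grade[of i]
  by (simp_all add: subspace_0 subspace_add subspace_diff subspace_scale subspace_neg)

lemma grade_both_zero: "x \<in> G 0 \<Longrightarrow> x \<in> G 1 \<Longrightarrow> x = 0"
  using grade_disjoint by blast

lemma mul_grades:
  shows "x \<in> G 0 \<Longrightarrow> y \<in> G i \<Longrightarrow> mul x y \<in> G i"
    and "x \<in> G i \<Longrightarrow> y \<in> G 0 \<Longrightarrow> mul x y \<in> G i"
    and "x \<in> G 1 \<Longrightarrow> y \<in> G 1 \<Longrightarrow> mul x y \<in> G 0"
    and "x \<in> G i \<Longrightarrow> y \<in> G i \<Longrightarrow> mul x y \<in> G 0"
  using mul_grade[of x 0 y i] mul_grade[of x i y 0] mul_grade[of x 1 y 1] mul_grade[of x i y i]
  by (cases i; simp)+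

lemma homogeneous_ext:
  assumes "\<And>i x. x \<in> G i \<Longrightarrow> f x = g x"
    and "\<And>x y. f (x + y) = f x + f y" and "\<And>x y. g (x + y) = g x + g y"
  shows "f x = (g x :: 'c::plus)"
proof -
  obtain x0 x1 where "x0 \<in> G 0" "x1 \<in> G 1" "x = x0 + x1"
    using grade_span by blast
  then show ?thesis
    using assms by metis
qed

lemma graded_span:
  assumes "\<And>v. v \<in> S \<Longrightarrow> \<exists>i. v \<in> G i"
  shows "graded_subspace (span S)"
proof -
  have "\<exists>x0\<in>span S \<inter> G 0. \<exists>x1\<in>span S \<inter> G 1. x = x0 + x1" if "x \<in> span S" for x
    using that
  proof (induction rule: span_induct_alt)
    case base
    show ?case
      using grade_closed(1) span_zero by (metis IntI add_0)
  next
    case (step c v y)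
    then obtain y0 y1 where y: "y0 \<in> span S \<inter> G 0" "y1 \<in> span S \<inter> G 1" "y = y0 + y1"
      by blast
    have cv: "scale c v \<in> span S"
      using step(1) by (simp add: span_base span_scale)
    obtain i where "v \<in> G i"
      using assms step(1) by blast
    then have "scale c v \<in> G 0 \<or> scale c v \<in> G 1"
      by (metis bit.exhaust grade_closed(4))
    then show ?case
    proof
      assume "scale c v \<in> G 0"
      then have "scale c v + y0 \<in> span S \<inter> G 0"
        using y cv by (simp add: span_add grade_closed)
      then show ?thesis
        using y by (metis add.assoc)
    next
      assume "scale c v \<in> G 1"
      then have "scale c v + y1 \<in> span S \<inter> G 1"
        using y cv by (simp add: span_add grade_closed)
      then show ?thesis
        using y by (metis add.left_commute)
    qed
  qed
  then show ?thesis
    unfolding graded_subspace_def by simp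
qed

text \<open>The projection onto the component of degree \<open>i\<close> along the other one.\<close>

definition component :: "bit \<Rightarrow> 'a \<Rightarrow> 'a" where
  "component i x = (THE y. y \<in> G i \<and> x - y \<in> G (i + 1))"

lemma component_eqI:
  assumes "y \<in> G i" "x - y \<in> G (i + 1)"
  shows "component i x = y"
  unfolding component_def
proof (rule the_equality)
  fix z assume z: "z \<in> G i \<and> x - z \<in> G (i + 1)"
  then have "z - y \<in> G i"
    using assms grade_closed(3) by blast
  moreover have "z - y \<in> G (i + 1)"
    using grade_closed(3)[OF assms(2) conjunct2[OF z]] by simp
  ultimately have "z - y = 0"
    using grade_both_zero[of "z - y"] by (cases i) auto
  then show "z = y"
    by simp
qed (use assms in blast)

lemma component_props: "component i x \<in> G i" "x - component i x \<in> G (i + 1)"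
proof -
  obtain x0 x1 where x: "x0 \<in> G 0" "x1 \<in> G 1" "x = x0 + x1"
    using grade_span by blast
  have "\<exists>y. y \<in> G i \<and> x - y \<in> G (i + 1)"
    by (cases i; rule exI[of _ "if i = 0 then x0 else x1"]) (use x in auto)
  then show "component i x \<in> G i" "x - component i x \<in> G (i + 1)"
    using component_eqI by blast+
qed

lemma component_homogeneous:
  shows "x \<in> G i \<Longrightarrow> component i x = x" and "x \<in> G i \<Longrightarrow> component (i + 1) x = 0"
  by (rule component_eqI; cases i; simp add: grade_closed)+

lemma component_zero: "component i 0 = 0"
  by (rule component_eqI) (simp_all add: grade_closed)

lemma component_linear:
  shows "component i (x + y) = component i x + component i y"
    and "component i (scale c x) = scale c (component i x)"
proof -
  show "component i (x + y) = component i x + component i y"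
  proof (rule component_eqI)
    show "x + y - (component i x + component i y) \<in> G (i + 1)"
      unfolding add_diff_add by (intro grade_closed component_props)
  qed (intro grade_closed component_props)
  show "component i (scale c x) = scale c (component i x)"
  proof (rule component_eqI)
    show "scale c x - scale c (component i x) \<in> G (i + 1)"
      unfolding scale_right_diff_distrib[symmetric] by (intro grade_closed component_props)
  qed (intro grade_closed component_props)
qed

lemma component_sum: "x = component 0 x + component 1 x"
proof -
  have "component 1 x = x - component 0 x"
    by (rule component_eqI) (use component_props[where x = x and i = 0] in auto)
  then show ?thesis
    by simp
qed

lemma component_mul:
  assumes "x \<in> G i"
  shows "component (i + j) (mul x y) = mul x (component j y)"
    and "component (i + j) (mul y x) = mul (component j y) x"
proof -
  note y = component_props[where x = y and i = j]
  have swap: "j + 1 + i = i + j + 1" "j + i = i + j"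
    by (simp_all only: add.commute add.left_commute)
  have "mul x y - mul x (component j y) \<in> G (i + j + 1)"
    using mul_grade[OF assms y(2)] by (simp only: mul_diff_right add.assoc)
  then show "component (i + j) (mul x y) = mul x (component j y)"
    by (rule component_eqI[OF mul_grade[OF assms y(1)]])
  have "mul y x - mul (component j y) x \<in> G (i + j + 1)"
    using mul_grade[OF y(2) assms] by (simp only: mul_diff_left swap)
  moreover have "mul (component j y) x \<in> G (i + j)"
    using mul_grade[OF y(1) assms] by (simp only: swap)
  ultimately show "component (i + j) (mul y x) = mul (component j y) x"
    by (rule component_eqI[rotated])
qed

end

section \<open>Simple Lie superalgebras\<close>

lemma super_sign_simps:
  "super_sign 0 i = 1" "super_sign i 0 = 1" "super_sign 1 1 = - 1"
  "super_sign i j * super_sign i j = 1"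
  "super_sign i (j + k) = super_sign i j * super_sign i k"
  "super_sign (j + k) i = super_sign j i * super_sign k i"
  by (rule bit.exhaust[of i]; rule bit.exhaust[of j]; rule bit.exhaust[of k];
      simp add: super_sign_def)+

lemma super_sign_commute: "super_sign i j = super_sign j i"
  by (simp add: super_sign_def conj_commute)

context lie_superalgebra
begin

lemma jacobi:
  assumes "x \<in> G i" "y \<in> G j"
  shows "mul x (mul y z) = mul (mul x y) z + scale (super_sign i j) (mul y (mul x z))"
proof (rule homogeneous_ext[where x = z])
  fix k z assume "z \<in> G k"
  then show "mul x (mul y z) = mul (mul x y) z + scale (super_sign i j) (mul y (mul x z))"
    by (rule super_jacobi[OF assms])
qed (simp_all add: mul_simps module_simps)

lemma mul_skew: "g \<in> G 0 \<Longrightarrow> mul g x = - mul x g"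
proof (rule homogeneous_ext[where x = x])
  fix i x assume "g \<in> G 0" "x \<in> G i"
  then show "mul g x = - mul x g"
    using super_anticomm[of g 0 x i] by (simp add: super_sign_simps)
qed (simp_all add: mul_simps)

lemma jacobi_even:
  assumes "g \<in> G 0"
  shows "mul g (mul y z) = mul (mul g y) z + mul y (mul g z)"
proof (rule homogeneous_ext[where x = y])
  fix i y assume "y \<in> G i"
  then show "mul g (mul y z) = mul (mul g y) z + mul y (mul g z)"
    using jacobi[of g 0 y i z] assms by (simp add: super_sign_simps)
qed (simp_all add: mul_simps)

lemma mul_odd_commute: "x \<in> G 1 \<Longrightarrow> y \<in> G 1 \<Longrightarrow> mul x y = mul y x"
  using super_anticomm[of x 1 y 1] by (simp add: super_sign_simps)

lemma mul_square: 
  assumes "x \<in> G 1" "y \<in> G 1"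
  shows "mul (mul x y) z = mul x (mul y z) + mul y (mul x z)"
  using jacobi[OF assms, of z] by (simp add: super_sign_simps)

end

locale simple_lie_superalgebra = lie_superalgebra scale G mul
  for scale :: "'f::field_char_0 \<Rightarrow> 'a::ab_group_add \<Rightarrow> 'a"
    and G :: "bit \<Rightarrow> 'a set"
    and mul :: "'a \<Rightarrow> 'a \<Rightarrow> 'a" +
  assumes finite_dimensional: "\<exists>B. finite B \<and> span B = UNIV"
    and odd_part_nonzero: "G 1 \<noteq> {0}"
    and is_simple: "simple"
begin

lemma ideal_full: "graded_ideal I \<Longrightarrow> v \<in> I \<Longrightarrow> v \<noteq> 0 \<Longrightarrow> I = UNIV"
  using is_simple unfolding simple_def by blast

lemma obtain_odd:
  obtains x where "x \<in> G 1" "x \<noteq> 0"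
  using odd_part_nonzero grade_closed(1) by blast

lemma graded_idealI:
  assumes "graded_subspace I"
    and "\<And>i j x y. x \<in> G i \<Longrightarrow> y \<in> I \<Longrightarrow> y \<in> G j \<Longrightarrow> mul x y \<in> I"
  shows "graded_ideal I"
proof -
  have I: "subspace I" "\<And>x. x \<in> I \<Longrightarrow> \<exists>x0\<in>I \<inter> G 0. \<exists>x1\<in>I \<inter> G 1. x = x0 + x1"
    using assms(1) unfolding graded_subspace_def by auto
  have hom: "mul x y \<in> I \<and> mul y x \<in> I" if "x \<in> G i" "y \<in> I" "y \<in> G j" for i j x y
  proof
    show "mul x y \<in> I"
      using assms(2) that by blast
    then show "mul y x \<in> I"
      using super_anticomm[of y j x i] that I(1) by (simp add: subspace_neg subspace_scale)
  qed
  have "mul x y \<in> I \<and> mul y x \<in> I" if y: "y \<in> I" for x y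
  proof -
    obtain y0 y1 where "y0 \<in> I" "y0 \<in> G 0" "y1 \<in> I" "y1 \<in> G 1" "y = y0 + y1"
      using I(2) y by blast
    moreover obtain x0 x1 where "x0 \<in> G 0" "x1 \<in> G 1" "x = x0 + x1"
      using grade_span by blast
    ultimately show ?thesis
      using hom I(1) by (simp add: mul_simps subspace_add)
  qed
  then show ?thesis
    using assms(1) unfolding graded_ideal_def by blast
qed

text \<open>
  The odd part and the brackets of its elements span a graded ideal; by simplicity it is
  everything, and its even component consists of the brackets.
\<close>

lemma even_part_eq: "G 0 = span {mul x y | x y. x \<in> G 1 \<and> y \<in> G 1}" (is "_ = span ?S")
proof
  have sub: "span ?S \<subseteq> G 0"
    by (rule span_minimal[OF _ subspace_grade]) (use mul_grades(3) in blast)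
  have "graded_ideal (span (?S \<union> G 1))"
  proof (rule graded_idealI)
    show "graded_subspace (span (?S \<union> G 1))"
      by (rule graded_span) (use mul_grades in blast)
    fix i j x y assume x: "x \<in> G i" and y: "y \<in> span (?S \<union> G 1)"
    have odd: "v \<in> span (?S \<union> G 1)" if "v \<in> G 1" for v
      using that by (simp add: span_base)
    have gen: "mul x y \<in> span (?S \<union> G 1)" if "y \<in> ?S \<union> G 1" for y
    proof (rule bit.exhaust[of i])
      assume 0: "i = 0"
      show ?thesis
        using that
      proof
        assume "y \<in> G 1"
        then show ?thesis
          using 0 x by (intro odd mul_grades) auto
      next
        assume "y \<in> ?S"
        then obtain a b where ab: "a \<in> G 1" "b \<in> G 1" "y = mul a b"
          by blast
        have "mul (mul x a) b \<in> ?S" "mul a (mul x b) \<in> ?S"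
          using ab x 0 mul_grades(1) by blast+
        then show ?thesis
          using ab x 0 by (simp add: jacobi_even span_add span_base)
      qed
    next
      assume 1: "i = 1"
      show ?thesis
        using that
      proof
        assume "y \<in> G 1"
        then have "mul x y \<in> ?S"
          using 1 x by blast
        then show ?thesis
          by (simp add: span_base)
      next
        assume "y \<in> ?S"
        then have "y \<in> G 0"
          using mul_grades(3) by blast
        then show ?thesis
          using 1 x by (intro odd mul_grades) auto
      qed
    qed
    show "mul x y \<in> span (?S \<union> G 1)"
      using y by (induction rule: span_induct_alt)
        (simp_all add: mul_simps span_zero span_add span_scale gen)
  qed
  moreover obtain x where "x \<in> G 1" "x \<noteq> 0"
    by (rule obtain_odd)
  ultimately have all: "span (?S \<union> G 1) = UNIV"
    by (intro ideal_full[of _ x]) (simp_all add: span_base)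
  show "G 0 \<subseteq> span ?S"
  proof
    fix g assume g: "g \<in> G 0"
    have "g \<in> span (?S \<union> G 1)"
      using all by simp
    then obtain a b where ab: "g = a + b" "a \<in> span ?S" "b \<in> span (G 1)"
      unfolding span_Un by blast
    have "b = g - a"
      using ab by simp
    then have "b \<in> G 0"
      using grade_closed(3) g ab(2) sub by blast
    then show "g \<in> span ?S"
      using ab grade_both_zero[of b] subspace_grade[of 1] by (simp add: span_eq_iff[THEN iffD2])
  qed
  show "span ?S \<subseteq> G 0"
    by (rule sub)
qed

lemma even_induct [consumes 1, case_names zero step]:
  assumes "g \<in> G 0" and "P 0"
    and "\<And>c x y g. x \<in> G 1 \<Longrightarrow> y \<in> G 1 \<Longrightarrow> g \<in> G 0 \<Longrightarrow> P g \<Longrightarrow> P (scale c (mul x y) + g)"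
  shows "P g"
proof -
  have "g \<in> span {mul x y | x y. x \<in> G 1 \<and> y \<in> G 1}"
    using assms(1) even_part_eq by simp
  then have "g \<in> G 0 \<and> P g"
  proof (induction rule: span_induct_alt)
    case base
    show ?case
      using assms(2) by (simp add: grade_closed)
  next
    case (step c v g)
    then obtain x y where "v = mul x y" "x \<in> G 1" "y \<in> G 1"
      by blast
    then show ?case
      using step assms(3) by (simp add: grade_closed mul_grades)
  qed
  then show ?thesis ..
qed

text \<open>
  Because the odd part generates the algebra, only odd multipliers have to be tested.
\<close>

lemma graded_ideal_oddI:
  assumes "graded_subspace I"
    and odd: "\<And>x y. x \<in> G 1 \<Longrightarrow> y \<in> I \<Longrightarrow> mul x y \<in> I"
  shows "graded_ideal I"
proof (rule graded_idealI)
  have sub: "subspace I"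
    using assms(1) unfolding graded_subspace_def by blast
  fix i j x y assume "x \<in> G i" and y: "y \<in> I"
  show "mul x y \<in> I"
  proof (rule bit.exhaust[of i])
    assume "i = 0"
    with \<open>x \<in> G i\<close> have "x \<in> G 0"
      by simp
    then show ?thesis
    proof (induction rule: even_induct)
      case zero
      show ?case
        using sub by (simp add: mul_simps subspace_0)
    next
      case (step c u v g)
      then show ?case
        using sub odd y by (simp add: mul_simps mul_square subspace_add subspace_scale)
    qed
  qed (use odd y \<open>x \<in> G i\<close> in simp)
qed (fact assms)

text \<open>
  Likewise the even part together with \<open>[G\<^sub>0, G\<^sub>1]\<close> is a graded ideal.
\<close>

lemma odd_part_eq: "G 1 = span {mul g x | g x. g \<in> G 0 \<and> x \<in> G 1}" (is "_ = span ?S")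
proof
  have sub: "span ?S \<subseteq> G 1"
    by (rule span_minimal[OF _ subspace_grade]) (use mul_grades(1) in blast)
  have "graded_ideal (span (G 0 \<union> ?S))"
  proof (rule graded_ideal_oddI)
    show "graded_subspace (span (G 0 \<union> ?S))"
      by (rule graded_span) (use mul_grades in blast)
    fix x y assume x: "x \<in> G 1" and y: "y \<in> span (G 0 \<union> ?S)"
    have gen: "mul x y \<in> span (G 0 \<union> ?S)" if "y \<in> G 0 \<union> ?S" for y
      using that
    proof
      assume y: "y \<in> G 0"
      then have "mul y x \<in> ?S"
        using x by blast
      moreover have "mul x y = - mul y x"
        using mul_skew[OF y] by simp
      ultimately show ?thesis
        by (simp add: span_base span_neg)
    next
      assume "y \<in> ?S"
      then have "mul x y \<in> G 0"
        using x mul_grades by blast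
      then show ?thesis
        by (simp add: span_base)
    qed
    show "mul x y \<in> span (G 0 \<union> ?S)"
      using y by (induction rule: span_induct_alt)
        (simp_all add: mul_simps span_zero span_add span_scale gen)
  qed
  moreover have "G 0 \<noteq> {0}"
  proof
    assume z: "G 0 = {0}"
    have all: "v \<in> G 1" for v
      using grade_span[of v] z by auto
    have "mul u v = 0" for u v
      using mul_grades(3)[OF all all, of u v] z by simp
    then show False
      using is_simple unfolding simple_def by blast
  qed
  then obtain g where "g \<in> G 0" "g \<noteq> 0"
    using grade_closed(1) by blast
  ultimately have all: "span (G 0 \<union> ?S) = UNIV"
    by (intro ideal_full[of _ g]) (simp_all add: span_base)
  show "G 1 \<subseteq> span ?S"
  proof
    fix x assume x: "x \<in> G 1"
    have "x \<in> span (G 0 \<union> ?S)"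
      using all by simp
    then obtain a b where ab: "x = a + b" "a \<in> span (G 0)" "b \<in> span ?S"
      unfolding span_Un by blast
    have "a = x - b"
      using ab by simp
    then have "a \<in> G 1"
      using grade_closed(3) x ab(3) sub by blast
    then show "x \<in> span ?S"
      using ab grade_both_zero[of a] subspace_grade[of 0] by (simp add: span_eq_iff[THEN iffD2])
  qed
  show "span ?S \<subseteq> G 1"
    by (rule sub)
qed

lemma odd_induct [consumes 1, case_names zero step]:
  assumes "x \<in> G 1" and "P 0"
    and "\<And>c g y x. g \<in> G 0 \<Longrightarrow> y \<in> G 1 \<Longrightarrow> x \<in> G 1 \<Longrightarrow> P x \<Longrightarrow> P (scale c (mul g y) + x)"
  shows "P x"
proof -
  have "x \<in> span {mul g x | g x. g \<in> G 0 \<and> x \<in> G 1}"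
    using assms(1) odd_part_eq by simp
  then have "x \<in> G 1 \<and> P x"
  proof (induction rule: span_induct_alt)
    case base
    show ?case
      using assms(2) by (simp add: grade_closed)
  next
    case (step c v x)
    then obtain g y where "v = mul g y" "g \<in> G 0" "y \<in> G 1"
      by blast
    then show ?case
      using step assms(3) by (simp add: grade_closed mul_grades)
  qed
  then show ?thesis ..
qed

text \<open>
  Because \<open>G\<^sub>1\<close> generates the algebra, an even element that annihilates \<open>G\<^sub>1\<close> is central.
\<close>

lemma even_faithful:
  assumes g: "g \<in> G 0" and kill: "\<And>x. x \<in> G 1 \<Longrightarrow> mul g x = 0"
  shows "g = 0"
proof (rule ccontr)
  assume "g \<noteq> 0"
  have "graded_ideal (span {g})"
  proof (rule graded_ideal_oddI)
    show "graded_subspace (span {g})"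
      by (rule graded_span) (use g in blast)
    fix x y assume x: "x \<in> G 1" and "y \<in> span {g}"
    then obtain k where "y = scale k g"
      unfolding span_singleton by blast
    moreover have "mul x g = 0"
      using mul_skew[OF g, of x] kill[OF x] by simp
    ultimately show "mul x y \<in> span {g}"
      by (simp add: mul_simps span_zero)
  qed
  then have "span {g} = UNIV"
    using \<open>g \<noteq> 0\<close> ideal_full span_base by blast
  moreover have "span {g} \<subseteq> G 0"
    by (rule span_minimal[OF _ subspace_grade]) (use g in blast)
  moreover obtain x where "x \<in> G 1" "x \<noteq> 0"
    by (rule obtain_odd)
  ultimately show False
    using grade_both_zero[of x] by auto
qed

section \<open>Superderivations with a factor\<close>

text \<open>
  The usual signs are restored here: a map of degree \<open>k\<close> that passes an element of degree \<open>i\<close>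
  picks up the sign $(-1)^{ki}$. With these signs the maps form a module over the whole
  superalgebra and not only over its even part.
\<close>

definition delta_superderivation :: "'f \<Rightarrow> bit \<Rightarrow> ('a \<Rightarrow> 'a) \<Rightarrow> bool" where
  "delta_superderivation d k f \<longleftrightarrow>
     Vector_Spaces.linear scale scale f \<and> (\<forall>i. \<forall>x\<in>G i. f x \<in> G (k + i)) \<and>
     (\<forall>i. \<forall>x\<in>G i. \<forall>y.
        f (mul x y) = scale d (mul (f x) y + scale (super_sign k i) (mul x (f y))))"

definition supercommutator :: "bit \<Rightarrow> 'a \<Rightarrow> ('a \<Rightarrow> 'a) \<Rightarrow> 'a \<Rightarrow> 'a" where
  "supercommutator k x f v = mul x (f v) - scale (super_sign k 1) (f (mul x v))"

lemma delta_superderivation_simps: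
  assumes "delta_superderivation d k f"
  shows "f (x + y) = f x + f y" and "f (scale c x) = scale c (f x)" and "f (x - y) = f x - f y"
    and "f (- x) = - f x" and "f 0 = 0"
proof -
  interpret Vector_Spaces.linear scale scale f
    using assms unfolding delta_superderivation_def by blast
  show "f (x + y) = f x + f y" "f (scale c x) = scale c (f x)" "f (x - y) = f x - f y"
    "f (- x) = - f x" "f 0 = 0"
    by (rule add scale diff neg zero)+
qed

lemma delta_superderivation_grade:
  "delta_superderivation d k f \<Longrightarrow> x \<in> G i \<Longrightarrow> f x \<in> G (k + i)"
  unfolding delta_superderivation_def by blast

lemma delta_superderivation_mul:
  "delta_superderivation d k f \<Longrightarrow> x \<in> G i \<Longrightarrow>
    f (mul x y) = scale d (mul (f x) y + scale (super_sign k i) (mul x (f y)))"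
  unfolding delta_superderivation_def by blast

lemma delta_superderivation_odd:
  assumes "delta_superderivation d k f" "x \<in> G 1"
  shows "f (mul x v) = scale d (mul (f x) v + scale (super_sign k 1) (mul x (f v)))"
  using delta_superderivation_mul[OF assms] .

lemma supercommutator_superderivation:
  assumes f: "delta_superderivation d k f" and x: "x \<in> G 1"
  shows "delta_superderivation d (k + 1) (supercommutator k x f)"
proof -
  let ?P = "supercommutator k x f"
  note lin = delta_superderivation_simps[OF f]
  have "Vector_Spaces.linear scale scale ?P"
    unfolding Vector_Spaces.linear_iff supercommutator_def
    by (simp add: lin mul_simps module_simps vector_space_axioms mult.commute)
  moreover have "?P y \<in> G (k + 1 + i)" if y: "y \<in> G i" for i y
  proof -
    have "mul x (f y) \<in> G (k + 1 + i)"
      using mul_grade[OF x delta_superderivation_grade[OF f y]] by (simp only: ac_simps)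
    moreover have "f (mul x y) \<in> G (k + 1 + i)"
      using delta_superderivation_grade[OF f mul_grade[OF x y]] by (simp only: ac_simps)
    ultimately show ?thesis
      unfolding supercommutator_def by (intro grade_closed)
  qed
  moreover have "?P (mul y z) =
      scale d (mul (?P y) z + scale (super_sign (k + 1) i) (mul y (?P z)))"
    if y: "y \<in> G i" for i y z
  proof -
    let ?s = "super_sign k 1 :: 'f" and ?t = "super_sign k i :: 'f" and ?r = "super_sign 1 i :: 'f"
    have signs: "super_sign 1 (k + i) = ?s * ?r" "super_sign k (1 + i) = ?s * ?t"
      "super_sign (k + 1) i = ?t * ?r" "?s * ?s = 1"
      by (simp_all only: super_sign_simps super_sign_commute[of 1 k])
    have 1: "mul x (mul (f y) z) = mul (mul x (f y)) z + scale (?s * ?r) (mul (f y) (mul x z))"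
      using jacobi[OF x delta_superderivation_grade[OF f y]] unfolding signs .
    have 2: "mul x (mul y w) = mul (mul x y) w + scale ?r (mul y (mul x w))" for w
      by (rule jacobi[OF x y])
    have 3: "f (mul (mul x y) z) =
        scale d (mul (f (mul x y)) z + scale (?s * ?t) (mul (mul x y) (f z)))"
      using delta_superderivation_mul[OF f mul_grade[OF x y]] unfolding signs .
    have 4: "f (mul y w) = scale d (mul (f y) w + scale ?t (mul y (f w)))" for w
      by (rule delta_superderivation_mul[OF f y])
    have s2: "?s * (?s * c) = c" for c
      using signs(4) by (simp flip: mult.assoc)
    show ?thesis
      unfolding supercommutator_def signs(3) 2[of z] lin 3 4
      by (simp add: mul_simps module_simps 1 2[of "f z"] algebra_simps s2)
  qed
  ultimately show ?thesis
    unfolding delta_superderivation_def by blast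
qed

lemma double_zero: "u = 0" if "u + u = 0" for u :: 'a
proof -
  have "scale 2 u = 0"
    using that scale_left_distrib[of 1 1 u] by simp
  then show ?thesis
    by (simp add: scale_eq_0_iff)
qed

lemma double_cancel: "u = w" if "u + u = w + w" for u w :: 'a
  using that double_zero[of "u - w"] by (simp add: algebra_simps)

context
  fixes d :: 'f
  assumes d_nontrivial: "d \<noteq> 0" "d \<noteq> 1"
begin

text \<open>
  This is \<open>X\<^sup>2 f = Y X\<close>. The value of \<open>f\<close> at \<open>[[x, x], v]\<close> can be expanded by the product rule for
  the even element \<open>[x, x]\<close>, or, after writing it as \<open>2 [x, [x, v]]\<close>, by applying the rule for \<open>x\<close>
  twice. The two results differ by \<open>2 (d - d\<^sup>2) (Y X - X\<^sup>2 f) v\<close>.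
\<close>

lemma square_delta_superderivation:
  assumes f: "delta_superderivation d k f" and x: "x \<in> G 1"
  shows "mul x (mul x (f v)) = mul (f x) (mul x v)"
proof -
  let ?s = "super_sign k 1 :: 'f"
  note lin = delta_superderivation_simps[OF f]
  note fx = delta_superderivation_odd[OF f x]
  have s2: "?s * ?s = 1" "?s * (?s * c) = c" for c
    by (simp_all only: super_sign_simps mult.assoc[symmetric] mult_1_left)
  have q: "mul (mul x x) w = mul x (mul x w) + mul x (mul x w)" for w
    by (rule mul_square[OF x x])
  have sgn: "super_sign 1 (k + 1) = - ?s" "super_sign (k + 1) 1 = - ?s"
    by (simp_all add: super_sign_simps super_sign_commute[of 1 k])
  have 1: "mul (mul x (f x)) v = mul x (mul (f x) v) + scale ?s (mul (f x) (mul x v))"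
    using jacobi[OF x delta_superderivation_grade[OF f x], of v]
    unfolding sgn by (simp add: algebra_simps)
  have 2: "mul (mul (f x) x) v = mul (f x) (mul x v) + scale ?s (mul x (mul (f x) v))"
    using jacobi[OF delta_superderivation_grade[OF f x] x, of v]
    unfolding sgn by (simp add: algebra_simps)
  have "f (mul (mul x x) v) = scale d (mul (f (mul x x)) v + mul (mul x x) (f v))"
    using delta_superderivation_mul[OF f mul_grades(3)[OF x x], of v]
    by (simp add: super_sign_simps)
  then have "0 = f (mul x (mul x v)) + f (mul x (mul x v))
      - scale d (mul (f (mul x x)) v + mul (mul x x) (f v))"
    by (simp add: q lin)
  also have "\<dots> = scale (d - d * d) (mul (f x) (mul x v) - mul x (mul x (f v)))
      + scale (d - d * d) (mul (f x) (mul x v) - mul x (mul x (f v)))"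
    by (simp add: fx q mul_simps module_simps 1 2 s2 algebra_simps)
  finally have "scale (d - d * d) (mul (f x) (mul x v) - mul x (mul x (f v))) = 0"
    using double_zero by metis
  moreover have "d - d * d \<noteq> 0"
    using d_nontrivial by simp
  ultimately show ?thesis
    by (simp add: scale_eq_0_iff)
qed

text \<open>
  The elements \<open>[x, x]\<close> and \<open>f x\<close> commute: evaluating \<open>X\<^sup>2 f = Y X\<close> at \<open>x\<close> yields
  \<open>[[x, x], f x] = 2 [f x, [x, x]]\<close>, and since \<open>[x, x]\<close> is even the two brackets are negatives of
  each other.
\<close>

lemma square_commutes_image:
  assumes f: "delta_superderivation d k f" and x: "x \<in> G 1"
  shows "mul x (mul x (mul (f x) v)) = mul (f x) (mul x (mul x v))"
proof -
  have q: "mul (mul x x) w = mul x (mul x w) + mul x (mul x w)" for w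
    by (rule mul_square[OF x x])
  note even = mul_grades(3)[OF x x]
  let ?t = "mul x (mul x (f x))"
  have "?t + ?t = - ?t"
    using mul_skew[OF even, of "f x"] square_delta_superderivation[OF f x, of x] by (simp add: q)
  then have "?t + ?t + ?t = 0"
    by (simp add: add_eq_0_iff)
  then have "scale 3 ?t = 0"
    using scale_left_distrib[of 2 1 ?t] scale_left_distrib[of 1 1 ?t] by simp
  then have "?t = 0"
    by (simp add: scale_eq_0_iff)
  then have "mul (mul x x) (mul (f x) v) = mul (f x) (mul (mul x x) v)"
    using jacobi_even[OF even, of "f x" v] by (simp add: q mul_simps)
  then show ?thesis
    unfolding q mul_add_right by (rule double_cancel)
qed

text \<open>
  Solving the product rule for \<open>X f\<close> and applying \<open>X\<^sup>2\<close> turns \<open>X (X\<^sup>2 f) = X Y X\<close> into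
  a relation between \<open>X Y X\<close> and \<open>X\<^sup>2 Y\<close>.
\<close>

lemma sandwiched_image:
  assumes f: "delta_superderivation d k f" and x: "x \<in> G 1"
  shows "scale (super_sign k 1 * d) (mul x (mul (f x) (mul x v))) =
    scale (1 - d) (mul x (mul x (mul (f x) v)))"
proof -
  let ?s = "super_sign k 1 :: 'f"
  note sq = square_delta_superderivation[OF f x]
  have "scale (?s * d) (mul x (f v)) = f (mul x v) - scale d (mul (f x) v)"
    using delta_superderivation_odd[OF f x, of v] by (simp add: module_simps mult.commute)
  then have "mul x (mul x (scale (?s * d) (mul x (f v)))) =
      mul (f x) (mul x (mul x v)) - scale d (mul x (mul x (mul (f x) v)))"
    by (simp add: mul_simps sq)
  then show ?thesis
    using sq[of v] by (simp add: mul_simps module_simps square_commutes_image[OF f x])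
qed

text \<open>
  Multiplying the relation between \<open>X Y X\<close> and \<open>X\<^sup>2 Y = Y X\<^sup>2\<close> by \<open>X\<close> on the left and on the right
  exchanges \<open>A = X\<^sup>2 Y X\<close> and \<open>B = X\<^sup>3 Y\<close>. Combining both versions gives \<open>d\<^sup>2 A = (1 - d)\<^sup>2 A\<close>, so
  that \<open>(2 d - 1) A = 0\<close>, and \<open>A = X\<^sup>4 f\<close>.
\<close>

lemma fourth_power_kills_image:
  assumes f: "delta_superderivation d k f" and x: "x \<in> G 1" and "d \<noteq> 1 / 2"
  shows "mul x (mul x (mul x (mul x (f v)))) = 0"
proof -
  let ?s = "super_sign k 1 :: 'f"
  let ?A = "mul x (mul x (mul (f x) (mul x v)))" and ?B = "mul x (mul x (mul x (mul (f x) v)))"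
  have s2: "?s * ?s = 1"
    by (rule super_sign_simps)
  have 1: "scale (?s * d) ?A = scale (1 - d) ?B"
    using arg_cong[OF sandwiched_image[OF f x, of v], of "mul x"] by (simp add: mul_simps)
  have 2: "scale (?s * d) ?B = scale (1 - d) ?A"
    using sandwiched_image[OF f x, of "mul x v"] square_commutes_image[OF f x, of v] by simp
  have "scale (d * d) ?A = scale (?s * d) (scale (?s * d) ?A)"
    using s2 by (simp add: algebra_simps flip: mult.assoc)
  also have "\<dots> = scale (1 - d) (scale (?s * d) ?B)"
    by (simp only: 1) (simp add: mult.commute)
  also have "\<dots> = scale ((1 - d) * (1 - d)) ?A"
    by (simp only: 2) simp
  finally have "scale (d * d - (1 - d) * (1 - d)) ?A = 0"
    by (simp add: module_simps)
  moreover have "d * d - (1 - d) * (1 - d) = 2 * d - 1"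
    by (simp add: algebra_simps)
  moreover have "2 * d - 1 \<noteq> 0"
    using \<open>d \<noteq> 1 / 2\<close> by (simp add: field_simps)
  ultimately have "?A = 0"
    by (simp add: scale_eq_0_iff)
  then show ?thesis
    using square_delta_superderivation[OF f x, of v] by simp
qed

end

lemma half_nontrivial: "(1 / 2 :: 'f) \<noteq> 0" "(1 / 2 :: 'f) \<noteq> 1"
  by simp_all

lemma supercommutator_add:
  assumes "delta_superderivation d k f"
  shows "supercommutator k (x + y) f v = supercommutator k x f v + supercommutator k y f v"
    and "supercommutator k (x - y) f v = supercommutator k x f v - supercommutator k y f v"
  by (simp_all add: supercommutator_def delta_superderivation_simps[OF assms] mul_simps module_simps)

text \<open>
  For the factor \<open>1/2\<close> the relation between \<open>X Y X\<close> and \<open>X\<^sup>2 Y\<close> is \<open>X Y X = \<plusminus> X\<^sup>2 Y\<close> and gives no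
  information on \<open>X\<^sup>4 f\<close>; indeed the identity map has this factor. The supercommutator \<open>P\<close> of \<open>X\<close>
  and \<open>f\<close> equals \<open>(X f \<mp> Y) / 2\<close>, and the same identities now show that it is annihilated by
  \<open>X\<^sup>2\<close> from both sides.
\<close>

lemma half_supercommutator:
  assumes f: "delta_superderivation (1 / 2) k f" and x: "x \<in> G 1"
  shows "mul x (supercommutator k x f v) =
      scale (- (super_sign k 1 + super_sign k 1)) (supercommutator k x f (mul x v))"
    and "mul x (mul x (supercommutator k x f v)) = 0"
    and "supercommutator k x f (mul x (mul x v)) = 0"
proof -
  let ?s = "super_sign k 1 :: 'f" and ?h = "1 / 2 :: 'f"
  note sq = square_delta_superderivation[OF half_nontrivial f x]
  note comm = square_commutes_image[OF half_nontrivial f x]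
  have s2: "?s * ?s = 1" "?s * (?s * c) = c" for c
    by (simp_all only: super_sign_simps mult.assoc[symmetric] mult_1_left)
  have "scale ?s (scale (?s * ?h) (mul x (mul (f x) (mul x v)))) =
      scale ?s (scale ?h (mul x (mul x (mul (f x) v))))" for v
    using sandwiched_image[OF half_nontrivial f x, of v] by simp
  then have "scale ?h (mul x (mul (f x) (mul x v))) =
      scale ?h (scale ?s (mul x (mul x (mul (f x) v))))" for v
    using s2 by (simp add: mult.commute mult.left_commute)
  then have XYX: "mul x (mul (f x) (mul x v)) = scale ?s (mul x (mul x (mul (f x) v)))" for v
    by (simp only: scale_left_imp_eq[OF half_nontrivial(1)])
  have fx: "f (mul x v) = scale ?h (mul (f x) v + scale ?s (mul x (f v)))" for v
    by (rule delta_superderivation_odd[OF f x])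
  have halves: "scale ?h u + scale ?h u = u" for u
    using scale_left_distrib[of ?h ?h u] by simp
  have P: "supercommutator k x f v = scale ?h (mul x (f v) - scale ?s (mul (f x) v))" for v
  proof -
    have "supercommutator k x f v =
        scale ?h (mul x (f v)) + scale ?h (mul x (f v)) - scale ?s (f (mul x v))"
      unfolding supercommutator_def halves ..
    then show ?thesis
      by (simp add: fx module_simps s2 mult.commute mult.left_commute)
  qed
  have P1: "mul x (supercommutator k x f v) =
      scale ?h (mul (f x) (mul x v) - scale ?s (mul x (mul (f x) v)))" for v
    by (simp add: P mul_simps sq)
  have P2: "supercommutator k x f (mul x v) =
      scale (?h * ?h) (mul x (mul (f x) v) - scale ?s (mul (f x) (mul x v)))" for v
  proof -
    have "supercommutator k x f (mul x v) = scale ?h (mul x (f (mul x v))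
        - scale ?s (scale ?h (mul (f x) (mul x v)) + scale ?h (mul (f x) (mul x v))))"
      unfolding halves by (rule P)
    then show ?thesis
      by (simp add: fx mul_simps module_simps sq s2 mult.commute mult.left_commute)
  qed
  show "mul x (supercommutator k x f v) =
      scale (- (?s + ?s)) (supercommutator k x f (mul x v))"
    unfolding P1 P2 by (simp add: module_simps s2 algebra_simps)
  show "mul x (mul x (supercommutator k x f v)) = 0"
    by (simp add: P1 mul_simps XYX)
  show "supercommutator k x f (mul x (mul x v)) = 0"
    by (simp add: P2 XYX comm)
qed

text \<open>
  Let \<open>P\<^sub>x\<close> be the supercommutator of \<open>X\<close> and \<open>f\<close>. The identities for \<open>X\<close> and \<open>P\<^sub>x\<close> are polarised
  in order to reach \<open>P\<^sub>z\<close>; they give \<open>X\<^sup>2 P\<^sub>z X\<^sup>2 = 0\<close>. On the other hand \<open>P\<^sub>z\<close> is itself a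
  superderivation with factor \<open>1/2\<close>, and the identities for it give \<open>X\<^sup>4 P\<^sub>z = X\<^sup>2 P\<^sub>z X\<^sup>2\<close>.
\<close>

lemma fourth_power_kills_supercommutator:
  assumes f: "delta_superderivation (1 / 2) k f" and x: "x \<in> G 1" and z: "z \<in> G 1"
  shows "mul x (mul x (mul x (mul x (supercommutator k z f v)))) = 0"
proof -
  let ?s = "super_sign k 1 :: 'f"
  let ?P = "\<lambda>x. supercommutator k x f"
  have lin: "?P x (u + w) = ?P x u + ?P x w" if "x \<in> G 1" for x u w
    using delta_superderivation_simps(1)[OF supercommutator_superderivation[OF f that]] .
  note add = supercommutator_add[OF f]
  note half = half_supercommutator[OF f]
  have polar1: "mul x (?P z w) + mul z (?P x w) = scale (- (?s + ?s)) (?P x (mul z w) + ?P z (mul x w))"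
    for w
  proof -
    have "mul x (?P z w) + mul z (?P x w) + scale (?s + ?s) (?P x (mul z w) + ?P z (mul x w)) = 0"
      using half(1)[OF grade_closed(2)[OF x z], of w] half(1)[OF x, of w] half(1)[OF z, of w]
      by (simp add: add mul_simps lin x z module_simps algebra_simps)
    then show ?thesis
      by (simp only: scale_minus_left eq_neg_iff_add_eq_0)
  qed
  have polar2: "mul x (mul x (?P z w)) + mul x (mul z (?P x w)) + mul z (mul x (?P x w)) = 0" for w
  proof -
    \<comment> \<open>the parts of \<open>X\<^sup>2 P\<^sub>x\<close> at \<open>x \<plusminus> z\<close> that are linear and quadratic in \<open>z\<close>\<close>
    let ?E = "mul x (mul x (?P z w)) + mul x (mul z (?P x w)) + mul z (mul x (?P x w))"
    let ?F = "mul z (mul z (?P x w)) + mul z (mul x (?P z w)) + mul x (mul z (?P z w))"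
    have "?F + ?E = 0"
      using half(2)[OF grade_closed(2)[OF x z], of w] half(2)[OF x, of w] half(2)[OF z, of w]
      by (simp add: add mul_simps algebra_simps)
    moreover have "?F - ?E = 0"
      using half(2)[OF grade_closed(3)[OF x z], of w] half(2)[OF x, of w] half(2)[OF z, of w]
      by (simp add: add mul_simps algebra_simps)
    ultimately have "?E + ?E = 0"
      by (metis add.right_inverse diff_eq_eq add_0)
    then show ?thesis
      by (rule double_zero)
  qed
  have "mul x (mul x (?P z (mul x (mul x w)))) = 0" for w
  proof -
    have "mul x (mul x (?P z (mul x w)) + mul z (?P x (mul x w))) =
        scale (- (?s + ?s)) (mul x (?P x (mul z (mul x w)) + ?P z (mul x (mul x w))))"
      by (simp add: polar1 mul_simps)
    moreover have "mul x (mul x (?P z (mul x w))) + mul x (mul z (?P x (mul x w))) =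
        - mul z (mul x (?P x (mul x w)))"
      using polar2[of "mul x w"] by (simp add: add_eq_0_iff2)
    moreover have "mul x (?P x (mul x w)) = 0"
      by (simp add: half(1,3) x)
    ultimately have "scale (- (?s + ?s)) (mul x (?P x (mul z (mul x w)) + ?P z (mul x (mul x w)))) = 0"
      by (simp add: mul_simps)
    moreover have "- (?s + ?s) \<noteq> 0"
      by (simp add: super_sign_def)
    ultimately have "mul x (?P x (mul z (mul x w)) + ?P z (mul x (mul x w))) = 0"
      using scale_eq_0_iff by blast
    then have "mul x (mul x (?P x (mul z (mul x w)) + ?P z (mul x (mul x w)))) = 0"
      by (simp add: mul_simps)
    then show ?thesis
      by (simp add: mul_simps half(2) x)
  qed
  moreover have "mul x (mul x (mul x (mul x (?P z v)))) = mul x (mul x (?P z (mul x (mul x v))))"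
  proof -
    define j where "j = k + 1"
    let ?t = "super_sign j 1 :: 'f"
    let ?Q = "supercommutator j x (?P z)"
    have P: "delta_superderivation (1 / 2) j (?P z)"
      unfolding j_def by (rule supercommutator_superderivation[OF f z])
    note half = half_supercommutator[OF P x]
    have t2: "?t * ?t = 1"
      by (rule super_sign_simps)
    have swap: "mul x (?P z w) = ?Q w + scale ?t (?P z (mul x w))" for w
      by (simp add: supercommutator_def)
    have "mul x (mul x (?P z v)) = mul x (?Q v) + scale ?t (?Q (mul x v)) + ?P z (mul x (mul x v))"
      by (simp add: swap mul_simps module_simps t2)
    also have "\<dots> = ?P z (mul x (mul x v)) - scale ?t (?Q (mul x v))"
      by (simp only: half(1) scale_minus_left scale_left_distrib) simp
    finally show ?thesis
      by (simp add: mul_simps half(2))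
  qed
  ultimately show ?thesis
    by simp
qed

text \<open>
  By \<open>x (g w) = [x, g] w \<plusminus> g (x w)\<close> the images of a family that is closed under supercommutators
  with odd elements span a graded ideal.
\<close>

lemma images_span:
  assumes D: "\<And>k f. D k f \<Longrightarrow> delta_superderivation d k f"
    and closed: "\<And>k f x. D k f \<Longrightarrow> x \<in> G 1 \<Longrightarrow> D (k + 1) (supercommutator k x f)"
    and nonzero: "D k f" "f v \<noteq> 0"
  shows "span {g w | j g w. D j g} = UNIV"
proof -
  define S where "S = {g w | j g w i. D j g \<and> w \<in> G i}"
  have memI: "g w \<in> S" if "D j g" "w \<in> G i" for j g w i
    unfolding S_def mem_Collect_eq
    by (rule exI[of _ j], rule exI[of _ g], rule exI[of _ w], rule exI[of _ i]) (use that in simp)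
  have memE: "\<exists>j g w i. u = g w \<and> D j g \<and> w \<in> G i" if "u \<in> S" for u
    using that unfolding S_def by simp
  have ideal: "graded_ideal (span S)"
  proof (rule graded_ideal_oddI)
    show "graded_subspace (span S)"
      by (rule graded_span) (use memE D delta_superderivation_grade in metis)
    fix x y assume x: "x \<in> G 1" and y: "y \<in> span S"
    have gen: "mul x u \<in> span S" if "u \<in> S" for u
    proof -
      from memE[OF that] obtain j g w i where u: "u = g w" "D j g" "w \<in> G i"
        by (elim exE conjE)
      have "supercommutator j x g w \<in> S"
        using closed[OF u(2) x] u(3) by (rule memI)
      moreover have "g (mul x w) \<in> S"
        using u(2) mul_grade[OF x u(3)] by (rule memI)
      moreover have "mul x u = supercommutator j x g w + scale (super_sign j 1) (g (mul x w))"
        by (simp add: supercommutator_def u(1))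
      ultimately show ?thesis
        by (simp add: span_add span_base span_scale)
    qed
    show "mul x y \<in> span S"
      using y by (induction rule: span_induct_alt)
        (simp_all add: mul_simps span_zero span_add span_scale gen)
  qed
  obtain w i where w: "w \<in> G i" "f w \<noteq> 0"
  proof -
    have "f (component 0 v) + f (component 1 v) \<noteq> 0"
      using nonzero(2) component_sum[of v] delta_superderivation_simps(1)[OF D[OF nonzero(1)]]
      by metis
    then have "f (component 0 v) \<noteq> 0 \<or> f (component 1 v) \<noteq> 0"
      by auto
    then show thesis
      using that component_props(1) by blast
  qed
  have "f w \<in> span S"
    using memI[OF nonzero(1) w(1)] by (rule span_base)
  then have "span S = UNIV"
    using ideal w(2) by (intro ideal_full[of _ "f w"])
  moreover have "span S \<subseteq> span {g w | j g w. D j g}"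
    by (rule span_mono) (auto simp: S_def)
  ultimately show ?thesis
    by blast
qed

lemma fourth_power_vanishes:
  assumes "\<And>k f. D k f \<Longrightarrow> delta_superderivation d k f"
    and "\<And>k f x. D k f \<Longrightarrow> x \<in> G 1 \<Longrightarrow> D (k + 1) (supercommutator k x f)"
    and "D k f" "f v \<noteq> 0"
    and kills: "\<And>k f v. D k f \<Longrightarrow> mul x (mul x (mul x (mul x (f v)))) = 0"
  shows "mul x (mul x (mul x (mul x w))) = 0"
proof -
  have "w \<in> span {g w | j g w. D j g}"
    using images_span[of D] assms(1-4) by blast
  then show ?thesis
    by (induction rule: span_induct_alt) (auto simp: mul_simps kills)
qed
section \<open>Nilpotent action of the even part\<close>

text \<open>
  Nilpotency of the action of \<open>S\<close>, without mention of powers: on every subquotient \<open>B / A\<close> of the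
  algebra that is stable under \<open>S\<close> and nonzero, \<open>S\<close> maps \<open>B / A\<close> into a proper subspace. In this form
  the property passes easily from \<open>S\<close> to a larger space.
\<close>

definition lowers :: "'a set \<Rightarrow> bool" where
  "lowers S \<longleftrightarrow> (\<forall>A B. subspace A \<longrightarrow> subspace B \<longrightarrow> A \<subset> B \<longrightarrow>
     (\<forall>s\<in>S. \<forall>a\<in>A. mul s a \<in> A) \<longrightarrow> (\<forall>s\<in>S. \<forall>b\<in>B. mul s b \<in> B) \<longrightarrow>
     span (A \<union> {mul s b | s b. s \<in> S \<and> b \<in> B}) \<noteq> B)"

text \<open>
  If \<open>C = A + S B\<close>, then \<open>u C \<subseteq> C\<close> because \<open>u\<close> normalises \<open>S\<close>. Were \<open>C + u B\<close> all of \<open>B\<close>, then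
  \<open>u B = u C + u (u B) \<subseteq> C\<close> and therefore \<open>B = C\<close>.
\<close>

lemma lowers_insert:
  assumes S: "lowers S" "subspace S" "S \<subseteq> G 0" and u: "u \<in> G 0"
    and norm: "\<And>s. s \<in> S \<Longrightarrow> mul u s \<in> S" and sq: "\<And>v. mul u (mul u v) = 0"
  shows "lowers (span (insert u S))"
  unfolding lowers_def
proof (intro allI impI notI)
  let ?T = "span (insert u S)"
  fix A B
  assume A: "subspace A" and B: "subspace B" and AB: "A \<subset> B"
    and TA: "\<forall>s\<in>?T. \<forall>a\<in>A. mul s a \<in> A" and TB: "\<forall>s\<in>?T. \<forall>b\<in>B. mul s b \<in> B"
    and full: "span (A \<union> {mul s b | s b. s \<in> ?T \<and> b \<in> B}) = B"
  define C where "C = span (A \<union> {mul s b | s b. s \<in> S \<and> b \<in> B})"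
  have uT: "u \<in> ?T"
    by (simp add: span_base)
  have ST: "s \<in> ?T" if "s \<in> S" for s
    using that by (simp add: span_base)
  have C_sub: "subspace C"
    unfolding C_def by (rule subspace_span)
  have CB: "C \<subseteq> B"
    unfolding C_def by (rule span_minimal) (use AB TB ST B in auto)
  have AC: "a \<in> C" if "a \<in> A" for a
    unfolding C_def using that by (simp add: span_base)
  have SC: "mul s b \<in> C" if "s \<in> S" "b \<in> B" for s b
    unfolding C_def using that by (intro span_base) blast
  have "C \<noteq> B"
    using S(1)[unfolded lowers_def, rule_format, OF A B AB] TA TB ST unfolding C_def by blast
  have uC: "mul u c \<in> C" if "c \<in> C" for c
    using that unfolding C_def
  proof (induction rule: span_induct_alt)
    case base
    show ?case
      by (simp add: mul_simps span_zero)
  next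
    case (step k w y)
    have "mul u w \<in> C"
      using step(1)
    proof
      assume "w \<in> A"
      then show ?thesis
        using TA uT AC by blast
    next
      assume "w \<in> {mul s b | s b. s \<in> S \<and> b \<in> B}"
      then obtain s b where w: "w = mul s b" "s \<in> S" "b \<in> B"
        by blast
      have "mul u w = mul (mul u s) b + mul s (mul u b)"
        unfolding w by (rule jacobi_even[OF u])
      then show ?thesis
        using SC norm w TB uT subspace_add[OF C_sub] by simp
    qed
    then show ?case
      using step(2) unfolding C_def[symmetric]
      by (simp add: mul_simps subspace_add[OF C_sub] subspace_scale[OF C_sub])
  qed
  have decompose: "\<exists>c b. c \<in> C \<and> b \<in> B \<and> v = c + mul u b" if "v \<in> B" for v
  proof -
    have "v \<in> span (A \<union> {mul s b | s b. s \<in> ?T \<and> b \<in> B})"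
      using that full by simp
    then show ?thesis
    proof (induction rule: span_induct_alt)
      case base
      show ?case
        by (rule exI[of _ 0], rule exI[of _ 0])
          (simp add: mul_simps subspace_0[OF C_sub] subspace_0[OF B])
    next
      case (step k w y)
      then obtain c b where y: "c \<in> C" "b \<in> B" "y = c + mul u b"
        by blast
      have "\<exists>c' b'. c' \<in> C \<and> b' \<in> B \<and> w = c' + mul u b'"
        using step(1)
      proof
        assume "w \<in> A"
        then show ?thesis
          using AC subspace_0[OF B] by (intro exI[of _ w] exI[of _ 0]) (simp add: mul_simps)
      next
        assume "w \<in> {mul s b | s b. s \<in> ?T \<and> b \<in> B}"
        then obtain t b' where w: "w = mul t b'" "t \<in> ?T" "b' \<in> B"
          by blast
        obtain m where "t - scale m u \<in> span S"
          using w(2) unfolding span_insert by blast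
        then have m: "t - scale m u \<in> S"
          using S(2) by (simp add: span_eq_iff[THEN iffD2])
        have "w = mul (t - scale m u) b' + mul u (scale m b')"
          by (simp add: w(1) mul_simps)
        then show ?thesis
          using SC[OF m w(3)] subspace_scale[OF B w(3)] by blast
      qed
      then obtain c' b' where w: "c' \<in> C" "b' \<in> B" "w = c' + mul u b'"
        by blast
      have "scale k w + y = (scale k c' + c) + mul u (scale k b' + b)"
        by (simp add: w y mul_simps module_simps add_ac)
      moreover have "scale k c' + c \<in> C" "scale k b' + b \<in> B"
        using w y by (simp_all add: subspace_add[OF C_sub] subspace_scale[OF C_sub]
            subspace_add[OF B] subspace_scale[OF B])
      ultimately show ?case
        by blast
    qed
  qed
  have "v \<in> C" if vB: "v \<in> B" for v
  proof -
    obtain c b where v: "c \<in> C" "b \<in> B" "v = c + mul u b"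
      using decompose[OF vB] by blast
    obtain c' b' where b: "c' \<in> C" "b' \<in> B" "b = c' + mul u b'"
      using decompose[OF v(2)] by blast
    have "v = c + mul u c'"
      by (simp add: v b mul_simps sq)
    then show ?thesis
      using v(1) uC[OF b(1)] subspace_add[OF C_sub] by simp
  qed
  then show False
    using CB \<open>C \<noteq> B\<close> by blast
qed

lemma finite_basis: "\<exists>B. finite_dimensional_vector_space scale B"
proof -
  obtain B where B: "finite B" "span B = UNIV"
    using finite_dimensional by blast
  obtain C where C: "independent C" "UNIV \<subseteq> span C"
    using maximal_independent_subset[of UNIV] by metis
  have "finite C"
    using independent_span_bound[OF B(1) C(1)] B(2) by simp
  then have "finite_dimensional_vector_space scale C"
    by unfold_locales (use C in auto)
  then show ?thesis
    by blast
qed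

text \<open>
  The argument of Engel and Jacobson for a set that is closed under the bracket but need not be a
  subspace. Let \<open>S\<close> be a maximal subalgebra that is spanned by elements of \<open>W\<close> and acts nilpotently.
  If \<open>W\<close> is not contained in \<open>S\<close>, then nilpotency of the action on the algebra itself yields an element
  of \<open>W\<close> outside \<open>S\<close> that normalises \<open>S\<close>, and adjoining it contradicts maximality. So \<open>W\<close> acts
  nilpotently. If \<open>W\<close> spanned \<open>G\<^sub>0\<close>, then \<open>[G\<^sub>0, G\<^sub>1]\<close> would be smaller than \<open>G\<^sub>1\<close>.
\<close>

lemma even_bracket_closed_span:
  assumes W: "W \<subseteq> G 0" "\<And>c e. c \<in> W \<Longrightarrow> e \<in> W \<Longrightarrow> mul c e \<in> W"
    and sq: "\<And>c v. c \<in> W \<Longrightarrow> mul c (mul c v) = 0"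
  shows "span W \<noteq> G 0"
proof
  assume full: "span W = G 0"
  obtain Bas where "finite_dimensional_vector_space scale Bas"
    using finite_basis by blast
  then interpret fd: finite_dimensional_vector_space scale Bas .
  define good where "good S \<longleftrightarrow>
    subspace S \<and> span (S \<inter> W) = S \<and> (\<forall>s\<in>S. \<forall>t\<in>S. mul s t \<in> S) \<and> lowers S" for S
  have "good {0}"
    unfolding good_def lowers_def
  proof (intro conjI allI impI)
    show "span ({0} \<inter> W) = {0}"
      by (cases "0 \<in> W") auto
    fix A B
    assume A: "subspace A" and AB: "A \<subset> B"
    have "span (A \<union> {mul s b | s b. s \<in> {0} \<and> b \<in> B}) \<subseteq> A"
      by (rule span_minimal[OF _ A]) (use subspace_0[OF A] in \<open>auto simp: mul_simps\<close>)
    then show "span (A \<union> {mul s b | s b. s \<in> {0} \<and> b \<in> B}) \<noteq> B"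
      using AB by blast
  qed (simp_all add: mul_simps)
  moreover have "\<forall>S. good S \<longrightarrow> dim S < Suc (dim UNIV)"
    by (intro allI impI le_imp_less_Suc fd.dim_subset subset_UNIV)
  ultimately have "\<exists>S. good S \<and> (\<forall>T. good T \<longrightarrow> dim T \<le> dim S)"
    by (rule Lattices_Big.ex_has_greatest_nat)
  then obtain S where S: "good S" and maxi: "\<And>T. good T \<Longrightarrow> dim T \<le> dim S"
    by (elim exE conjE) simp
  have S_sub: "subspace S" and S_span: "span (S \<inter> W) = S"
    and S_mul: "\<And>s t. s \<in> S \<Longrightarrow> t \<in> S \<Longrightarrow> mul s t \<in> S" and S_low: "lowers S"
    using S unfolding good_def by blast+
  have S_even: "S \<subseteq> G 0"
    using span_minimal[OF _ subspace_grade[of 0], of "S \<inter> W"] W(1) unfolding S_span by blast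
  have "W \<subseteq> S"
  proof (rule ccontr)
    assume "\<not> W \<subseteq> S"
    \<comment> \<open>In a minimal stable space \<open>B\<close> with elements of \<open>W\<close> outside \<open>S\<close>, the elements of \<open>S\<close> push
      those elements into a smaller stable space, hence into \<open>S\<close>.\<close>
    define inv where "inv B \<longleftrightarrow>
      subspace B \<and> S \<subseteq> B \<and> (\<forall>s\<in>S. \<forall>b\<in>B. mul s b \<in> B) \<and> \<not> W \<inter> B \<subseteq> S" for B
    have "inv UNIV"
      unfolding inv_def using \<open>\<not> W \<subseteq> S\<close> by simp
    then have "\<exists>B. inv B \<and> (\<forall>C. inv C \<longrightarrow> dim B \<le> dim C)"
      by (rule ex_has_least_nat)
    then obtain B where B: "inv B" and mini: "\<And>C. inv C \<Longrightarrow> dim B \<le> dim C"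
      by (elim exE conjE) simp
    have B_sub: "subspace B" and SB: "S \<subseteq> B" and B_mul: "\<And>s b. s \<in> S \<Longrightarrow> b \<in> B \<Longrightarrow> mul s b \<in> B"
      and B_W: "\<not> W \<inter> B \<subseteq> S"
      using B unfolding inv_def by blast+
    define C where "C = span (S \<union> {mul s b | s b. s \<in> S \<and> b \<in> B})"
    have C_sub: "subspace C"
      unfolding C_def by (rule subspace_span)
    have CB: "C \<subseteq> B"
      unfolding C_def by (rule span_minimal[OF _ B_sub]) (use SB B_mul in auto)
    have "S \<subset> B"
      using SB B_W by blast
    then have "C \<noteq> B"
      using S_low[unfolded lowers_def, rule_format, OF S_sub B_sub] S_mul B_mul
      unfolding C_def by blast
    then have "dim C < dim B"
      using CB B_sub C_sub fd.dim_psubset[of C B] by (simp add: span_eq_iff[THEN iffD2] psubset_eq)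
    then have "\<not> inv C"
      using mini not_le by blast
    moreover have SC: "mul s b \<in> C" if "s \<in> S" "b \<in> B" for s b
      unfolding C_def using that by (intro span_base) blast
    moreover have "S \<subseteq> C"
      unfolding C_def using span_superset by blast
    ultimately have WC: "W \<inter> C \<subseteq> S"
      unfolding inv_def using C_sub CB by blast
    obtain u where u: "u \<in> W" "u \<in> B" "u \<notin> S"
      using B_W by blast
    have u_even: "u \<in> G 0"
      using u(1) W(1) by blast
    have gen: "mul s u \<in> S" if "s \<in> S" for s
    proof -
      have "s \<in> span (S \<inter> W)"
        using that by (simp only: S_span)
      then show ?thesis
      proof (induction rule: span_induct_alt)
        case base
        show ?case
          by (simp add: mul_simps subspace_0[OF S_sub])
      next
        case (step k w y)
        then have "mul w u \<in> S"
          using WC W(2) u SC by blast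
        then show ?case
          using step by (simp add: mul_simps subspace_add[OF S_sub] subspace_scale[OF S_sub])
      qed
    qed
    have gen': "mul u s \<in> S" if "s \<in> S" for s
      using gen[OF that] mul_skew[OF u_even, of s] subspace_neg[OF S_sub] by simp
    let ?T = "span (insert u S)"
    have "good ?T"
      unfolding good_def
    proof (intro conjI ballI)
      show "span (?T \<inter> W) = ?T"
      proof
        have "S \<subseteq> span (?T \<inter> W)"
          using span_mono[of "S \<inter> W" "?T \<inter> W"] span_superset[of "insert u S"]
          unfolding S_span by blast
        moreover have "u \<in> span (?T \<inter> W)"
          using u(1) by (simp add: span_base)
        ultimately show "?T \<subseteq> span (?T \<inter> W)"
          by (intro span_minimal subspace_span) simp
        show "span (?T \<inter> W) \<subseteq> ?T"
          by (intro span_minimal subspace_span) simp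
      qed
      fix s t assume "s \<in> ?T" "t \<in> ?T"
      then obtain a b where "s - scale a u \<in> S" "t - scale b u \<in> S"
        unfolding span_insert using S_sub by (auto simp: span_eq_iff[THEN iffD2])
      moreover define s' t' where "s' = s - scale a u" and "t' = t - scale b u"
      ultimately have st: "s' \<in> S" "t' \<in> S" "s = s' + scale a u" "t = t' + scale b u"
        by simp_all
      have "mul u u = 0"
        using mul_skew[OF u_even, of u] double_zero[of "mul u u"] by (simp add: eq_neg_iff_add_eq_0)
      then have "mul s t \<in> S"
        using st gen gen' S_mul
        by (simp add: mul_simps subspace_add[OF S_sub] subspace_scale[OF S_sub])
      then show "mul s t \<in> ?T"
        by (simp add: span_base)
    next
      show "lowers ?T"
        by (rule lowers_insert[OF S_low S_sub S_even u_even gen' sq[OF u(1)]])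
    qed (rule subspace_span)
    then have "dim ?T \<le> dim S"
      by (rule maxi)
    moreover have "S \<subset> ?T"
      using u(3) by (auto intro: span_base)
    then have "dim S < dim ?T"
      using S_sub fd.dim_psubset[of S ?T] by (simp add: span_eq_iff[THEN iffD2])
    ultimately show False
      by simp
  qed
  then have "S = G 0"
    using span_minimal[OF _ S_sub] full S_even by blast
  then have "lowers (G 0)"
    using S_low by simp
  moreover have "{0} \<subset> G 1"
    using odd_part_nonzero grade_closed(1) by blast
  ultimately have "span ({0} \<union> {mul s b | s b. s \<in> G 0 \<and> b \<in> G 1}) \<noteq> G 1"
    by (rule lowers_def[THEN iffD1, rule_format, OF _ subspace_single_0 subspace_grade])
      (simp_all add: mul_zero_right mul_grades(1))
  then show False
    using odd_part_eq by (simp add: span_insert_0)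
qed

text \<open>
  If \<open>C\<^sup>2 = E\<^sup>2 = 0\<close> for the multiplications by the even elements \<open>c\<close> and \<open>e\<close>, then \<open>[c, [c, e]] = 0\<close>
  gives \<open>C E C = 0\<close>, and symmetrically \<open>E C E = 0\<close>, so that \<open>(C E - E C)\<^sup>2 = 0\<close>. Hence the set of these
  elements is closed under the bracket. It contains all \<open>[x, x]\<close> if \<open>X\<^sup>4 = 0\<close> for all odd \<open>x\<close>, and the
  squares \<open>[x, x]\<close> span \<open>G\<^sub>0\<close> by polarisation.
\<close>

lemma exists_odd_fourth_power:
  "\<exists>x\<in>G 1. \<exists>v. mul x (mul x (mul x (mul x v))) \<noteq> 0"
proof (rule ccontr)
  assume "\<not> ?thesis"
  then have fourth: "mul x (mul x (mul x (mul x v))) = 0" if "x \<in> G 1" for x v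
    using that by blast
  define W where "W = {c \<in> G 0. \<forall>v. mul c (mul c v) = 0}"
  have "span W \<noteq> G 0"
  proof (rule even_bracket_closed_span)
    fix c e assume c: "c \<in> W" and e: "e \<in> W"
    have even: "c \<in> G 0" "e \<in> G 0" "mul c e \<in> G 0"
      and sq: "mul c (mul c v) = 0" "mul e (mul e v) = 0" for v
      using c e mul_grades(1) unfolding W_def by auto
    have bracket: "mul (mul g h) v = mul g (mul h v) - mul h (mul g v)" if "g \<in> G 0" for g h v
      using jacobi_even[OF that, of h v] by (simp add: algebra_simps)
    have "mul c (mul e (mul c v)) + mul c (mul e (mul c v)) = 0" for v
      using bracket[of c "mul c e" v] bracket[of c e] even sq
      by (simp add: mul_simps neg_eq_iff_add_eq_0)
    then have cec: "mul c (mul e (mul c v)) = 0" for v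
      by (rule double_zero)
    have "mul e (mul c (mul e v)) + mul e (mul c (mul e v)) = 0" for v
      using bracket[of e "mul e c" v] bracket[of e c] even sq
      by (simp add: mul_simps neg_eq_iff_add_eq_0)
    then have ece: "mul e (mul c (mul e v)) = 0" for v
      by (rule double_zero)
    show "mul c e \<in> W"
      unfolding W_def using even by (simp add: bracket mul_simps sq cec ece)
  qed (auto simp: W_def)
  moreover have "mul x y \<in> span W" if "x \<in> G 1" "y \<in> G 1" for x y
  proof -
    have square: "mul z z \<in> span W" if "z \<in> G 1" for z
    proof -
      have "mul z z \<in> W"
        unfolding W_def using that fourth[OF that]
        by (simp add: mul_grades mul_square[OF that that] mul_simps)
      then show ?thesis
        by (rule span_base)
    qed
    have "mul (x + y) (x + y) - mul x x - mul y y = scale 2 (mul x y)"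
      using mul_odd_commute[OF that] scale_left_distrib[of 1 1 "mul x y"] by (simp add: mul_simps)
    then have "scale (1 / 2) (mul (x + y) (x + y) - mul x x - mul y y) = mul x y"
      by simp
    then show ?thesis
      using square that grade_closed(2) span_scale span_diff by metis
  qed
  then have "G 0 \<subseteq> span W"
    unfolding even_part_eq by (intro span_minimal subspace_span) blast
  moreover have "span W \<subseteq> G 0"
    by (rule span_minimal[OF _ subspace_grade]) (auto simp: W_def)
  ultimately show False
    by blast
qed
section \<open>Odd maps without signs\<close>

text \<open>
  Applying \<open>g\<close> to both sides of \<open>[x, y] = [y, x]\<close> for odd \<open>x, y\<close> shows that \<open>[x, g y]\<close> is symmetric and
  that \<open>g\<close> vanishes on \<open>[G\<^sub>1, G\<^sub>1] = G\<^sub>0\<close>. So on \<open>G\<^sub>1\<close> the map \<open>g\<close> intertwines the actions of \<open>G\<^sub>0\<close> up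
  to the factor \<open>d\<close>. Acting twice, commutators in \<open>G\<^sub>0\<close> pick up both \<open>d\<close> and \<open>d\<^sup>2\<close>, hence annihilate
  the image \<open>V = g(G\<^sub>1)\<close>. On the other hand \<open>V = [G\<^sub>0, V]\<close> consists of commutators, which leads to
  \<open>[V, [V, G\<^sub>1]] = 0\<close>. A complement of the submodule \<open>[V, G\<^sub>1]\<close> of \<open>G\<^sub>1\<close> is then annihilated by \<open>V\<close>
  too, and \<open>V = 0\<close> since \<open>G\<^sub>0\<close> acts faithfully.
\<close>

lemma odd_delta_derivation_zero:
  assumes d: "d \<noteq> 0" "d \<noteq> 1"
    and lin: "Vector_Spaces.linear scale scale g"
    and odd: "\<And>i x. x \<in> G i \<Longrightarrow> g x \<in> G (1 + i)"
    and rule: "\<And>x y. g (mul x y) = scale d (mul x (g y) + mul (g x) y)"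
    and reducible: "G1_completely_reducible"
  shows "g v = 0"
proof -
  interpret g: Vector_Spaces.linear scale scale g
    by (rule lin)
  have g_odd: "g x \<in> G 0" if "x \<in> G 1" for x
    using odd[OF that] by simp
  have cancel: "u = w" if "scale d u = scale d w" for u w
    using that d(1) by simp
  have g_commute: "mul x (g y) = mul y (g x)" if "x \<in> G 1" "y \<in> G 1" for x y
  proof -
    have "scale d (mul x (g y) + mul (g x) y) = scale d (mul y (g x) + mul (g y) x)"
      using mul_odd_commute[OF that] rule by metis
    then have "mul x (g y) - mul y (g x) = mul y (g x) - mul x (g y)"
      using cancel mul_skew[OF g_odd[OF that(1)], of y] mul_skew[OF g_odd[OF that(2)], of x] by auto
    then have "mul x (g y) - mul y (g x) + (mul x (g y) - mul y (g x)) = 0"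
      by (simp add: algebra_simps)
    then show ?thesis
      using double_zero[of "mul x (g y) - mul y (g x)"] by simp
  qed
  have g_bracket: "g (mul x y) = 0" if "x \<in> G 1" "y \<in> G 1" for x y
    using rule[of x y] g_commute[OF that] mul_skew[OF g_odd[OF that(1)], of y] by simp
  have g_even: "g h = 0" if "h \<in> G 0" for h
    using that by (induction rule: even_induct) (simp_all add: g.zero g.add g.scale g_bracket)
  have g_equivariant: "g (mul h y) = scale d (mul h (g y))" if "h \<in> G 0" for h y
    using rule[of h y] g_even[OF that] by (simp add: mul_simps)
  have bracket: "mul (mul h k) w = mul h (mul k w) - mul k (mul h w)" if "h \<in> G 0" for h k w
    using jacobi_even[OF that, of k w] by (simp only: eq_diff_eq)
  have derived_kills: "mul (mul h k) (g y) = 0" if "h \<in> G 0" "k \<in> G 0" for h k y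
  proof -
    have "scale d (mul (mul h k) (g y)) = g (mul (mul h k) y)"
      by (rule g_equivariant[OF mul_grades(1)[OF that], symmetric])
    also have "\<dots> = scale (d * d) (mul (mul h k) (g y))"
      by (simp only: bracket[OF that(1)] g.diff g_equivariant[OF that(1)] g_equivariant[OF that(2)]
          mul_scale_right scale_right_diff_distrib scale_scale)
    finally have "scale (d * (1 - d)) (mul (mul h k) (g y)) = 0"
      by (simp only: right_diff_distrib mult_1_right scale_left_diff_distrib diff_self)
    moreover have "d * (1 - d) \<noteq> 0"
      using d by simp
    ultimately show ?thesis
      using scale_eq_0_iff by blast
  qed
  \<comment> \<open>\<open>h\<close> applied to the symmetric expression \<open>[x, g y]\<close>, where \<open>[h, g y]\<close> is \<open>g (h y)\<close> up to \<open>1 / d\<close>\<close>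
  have balanced: "mul (mul h x) (g y) = mul x (g (mul h y))"
    if h: "h \<in> G 0" and x: "x \<in> G 1" and y: "y \<in> G 1" for h x y
  proof -
    have expand: "scale d (mul h (mul x (g y))) = scale d (mul (mul h x) (g y)) + mul x (g (mul h y))"
      for x y
      using jacobi_even[OF h, of x "g y"] by (simp add: g_equivariant[OF h] mul_simps module_simps)
    have "scale d (mul (mul h x) (g y)) + mul x (g (mul h y)) =
        scale d (mul (mul h y) (g x)) + mul y (g (mul h x))"
      using expand[of x y] expand[of y x] g_commute[OF x y] by simp
    moreover have "mul (mul h y) (g x) = mul x (g (mul h y))" "mul y (g (mul h x)) = mul (mul h x) (g y)"
      using g_commute mul_grades(1)[OF h] x y by metis+
    ultimately have "scale (1 - d) (mul (mul h x) (g y) - mul x (g (mul h y))) = 0"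
      by (simp add: module_simps algebra_simps)
    then show ?thesis
      using d(2) by simp
  qed
  have derived_zero: "mul (g y) (mul (mul h k) x) = 0"
    if "h \<in> G 0" "k \<in> G 0" and x: "x \<in> G 1" and y: "y \<in> G 1" for h k x y
  proof -
    have hk: "mul h k \<in> G 0"
      using that by (simp add: mul_grades)
    have "mul (mul (mul h k) x) (g y) = 0"
      using balanced[OF hk x y] g_equivariant[OF hk] derived_kills[OF that(1,2)]
      by (simp add: mul_simps)
    then show ?thesis
      using mul_skew[OF g_odd[OF y]] by simp
  qed
  have square_zero: "mul (g y) (mul (g z) x) = 0" if x: "x \<in> G 1" and y: "y \<in> G 1" and z: "z \<in> G 1"
    for x y z
    using z
  proof (induction rule: odd_induct)
    case zero
    show ?case
      by (simp add: g.zero mul_simps)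
  next
    case (step c h u w)
    then show ?case
      using derived_zero[OF _ g_odd x y]
      by (simp add: g.add g.scale g_equivariant mul_simps)
  qed
  define N where "N = span {mul (g y) x | x y. x \<in> G 1 \<and> y \<in> G 1}"
  have N_sub: "subspace N"
    unfolding N_def by (rule subspace_span)
  have N_gen: "mul (g y) x \<in> N" if "x \<in> G 1" "y \<in> G 1" for x y
    unfolding N_def using that by (intro span_base) blast
  have N_odd: "N \<subseteq> G 1"
    unfolding N_def by (rule span_minimal[OF _ subspace_grade]) (use mul_grades(1) g_odd in blast)
  have "mul h n \<in> N" if h: "h \<in> G 0" and n: "n \<in> N" for h n
    using n unfolding N_def
  proof (induction rule: span_induct_alt)
    case base
    show ?case
      by (simp add: mul_simps span_zero)
  next
    case (step c w u)
    then obtain x y where w: "w = mul (g y) x" "x \<in> G 1" "y \<in> G 1"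
      by blast
    have "scale d (mul h w) = mul (g (mul h y)) x + scale d (mul (g y) (mul h x))"
      using jacobi_even[OF h, of "g y" x]
      by (simp add: w(1) g_equivariant[OF h] mul_simps module_simps)
    moreover have "\<dots> \<in> N"
      using w mul_grades(1)[OF h] N_gen subspace_add[OF N_sub] subspace_scale[OF N_sub] by simp
    ultimately have "scale (inverse d) (scale d (mul h w)) \<in> N"
      using subspace_scale[OF N_sub] by simp
    then have "mul h w \<in> N"
      using d(1) by simp
    then show ?case
      using step(2) unfolding N_def[symmetric]
      by (simp add: mul_simps subspace_add[OF N_sub] subspace_scale[OF N_sub])
  qed
  then have "G0_submodule N"
    unfolding G0_submodule_def using N_sub N_odd by blast
  then obtain W where "G0_submodule W" "N \<inter> W = {0}"
    and split: "\<forall>x\<in>G 1. \<exists>n\<in>N. \<exists>w\<in>W. x = n + w"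
    using reducible unfolding G1_completely_reducible_def by metis
  then have W: "W \<subseteq> G 1" "\<And>h w. h \<in> G 0 \<Longrightarrow> w \<in> W \<Longrightarrow> mul h w \<in> W" "N \<inter> W = {0}"
    unfolding G0_submodule_def by simp_all
  have kills: "mul (g y) x = 0" if x: "x \<in> G 1" and y: "y \<in> G 1" for x y
  proof -
    obtain n w where nw: "n \<in> N" "w \<in> W" "x = n + w"
      using split x by blast
    have "mul (g y) n = 0"
      using nw(1) unfolding N_def
      by (induction rule: span_induct_alt) (use square_zero[OF _ y] in \<open>auto simp: mul_simps\<close>)
    moreover have "mul (g y) w \<in> N \<inter> W"
      using W(1) W(2)[OF g_odd[OF y] nw(2)] N_gen[OF _ y] nw(2)
      by (simp add: subset_iff)
    then have "mul (g y) w = 0"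
      using W(3) by simp
    ultimately show ?thesis
      by (simp add: nw(3) mul_simps)
  qed
  have "g x = 0" if "x \<in> G 1" for x
    using even_faithful[OF g_odd[OF that]] kills that by blast
  then have "g (component 0 v) + g (component 1 v) = 0"
    using g_even component_props(1) by simp
  then show ?thesis
    using component_sum[of v] g.add by metis
qed

section \<open>Even maps\<close>

text \<open>
  The component of \<open>f\<close> that reverses the parity is called \<open>g\<close> in the proof. The product rule without
  signs is compatible with taking components, and on parity-preserving maps it agrees with the rule
  with signs.
\<close>

lemma delta_derivation_is_superderivation:
  assumes f: "delta_derivation scale mul d f" and d: "d \<noteq> 0" "d \<noteq> 1"
    and reducible: "G1_completely_reducible"
  shows "delta_superderivation d 0 f"
proof -
  interpret f: Vector_Spaces.linear scale scale f
    using f unfolding delta_derivation_def by blast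
  have rule: "f (mul x y) = scale d (mul x (f y) + mul (f x) y)" for x y
    using f unfolding delta_derivation_def by blast
  define g where "g v = component 1 (f (component 0 v)) + component 0 (f (component 1 v))" for v
  have g_hom: "g x = component (1 + i) (f x)" if x: "x \<in> G i" for i x
  proof (rule bit.exhaust[of i])
    assume "i = 0"
    then show ?thesis
      using x component_homogeneous[of x 0] by (simp add: g_def f.zero component_zero)
  next
    assume "i = 1"
    then show ?thesis
      using x component_homogeneous[of x 1] by (simp add: g_def f.zero component_zero)
  qed
  have g_lin: "Vector_Spaces.linear scale scale g"
    unfolding Vector_Spaces.linear_iff g_def
    by (simp add: vector_space_axioms component_linear f.add f.scale module_simps algebra_simps)
  then interpret g: Vector_Spaces.linear scale scale g .
  have g_rule_hom: "g (mul x y) = scale d (mul x (g y) + mul (g x) y)"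
    if x: "x \<in> G i" and y: "y \<in> G j" for i j x y
  proof -
    have "1 + (i + j) = i + (1 + j)" "1 + (i + j) = j + (1 + i)"
      by (simp_all only: ac_simps)
    then have "component (1 + (i + j)) (mul x (f y)) = mul x (component (1 + j) (f y))"
      "component (1 + (i + j)) (mul (f x) y) = mul (component (1 + i) (f x)) y"
      using component_mul[OF x, of "1 + j" "f y"] component_mul[OF y, of "1 + i" "f x"] by simp_all
    then show ?thesis
      by (simp only: g_hom[OF mul_grade[OF x y]] g_hom[OF x] g_hom[OF y] rule component_linear)
  qed
  have g_rule_left: "g (mul x y) = scale d (mul x (g y) + mul (g x) y)" if x: "x \<in> G i" for i x y
    by (rule homogeneous_ext[where x = y])
      (simp_all add: g_rule_hom[OF x] mul_simps g.add module_simps algebra_simps)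
  have g_rule: "g (mul x y) = scale d (mul x (g y) + mul (g x) y)" for x y
    by (rule homogeneous_ext[where x = x])
      (simp_all add: g_rule_left mul_simps g.add module_simps algebra_simps)
  have g_grade: "g x \<in> G (1 + i)" if "x \<in> G i" for i x
    unfolding g_hom[OF that] by (rule component_props)
  have "g v = 0" for v
    using odd_delta_derivation_zero[OF d g_lin g_grade g_rule reducible] .
  then have "f x \<in> G (0 + i)" if "x \<in> G i" for i x
  proof -
    have "component (1 + i) (f x) = 0"
      using \<open>g x = 0\<close> g_hom[OF that] by simp
    then show ?thesis
      using component_props(2)[where x = "f x" and i = "1 + i"] by (simp add: ac_simps)
  qed
  then show ?thesis
    unfolding delta_superderivation_def
    by (simp add: f.linear_axioms rule super_sign_simps add.commute)
qed

lemma delta_superderivation_zero: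
  assumes f: "delta_superderivation d k f" and d: "d \<noteq> 0" "d \<noteq> 1" "d \<noteq> 1 / 2"
  shows "f v = 0"
proof (rule ccontr)
  assume "f v \<noteq> 0"
  obtain x w where x: "x \<in> G 1" and "mul x (mul x (mul x (mul x w))) \<noteq> 0"
    using exists_odd_fourth_power by blast
  moreover have "mul x (mul x (mul x (mul x w))) = 0"
  proof (rule fourth_power_vanishes[where D = "delta_superderivation d" and d = d])
    show "delta_superderivation d k f" "f v \<noteq> 0"
      by fact+
    show "mul x (mul x (mul x (mul x (f v)))) = 0" if "delta_superderivation d k f" for k f v
      by (rule fourth_power_kills_image[OF d(1,2) that x d(3)])
  qed (assumption | rule supercommutator_superderivation)+
  ultimately show False
    by blast
qed

text \<open>
  Here the argument is applied to the supercommutators instead of the maps themselves; they form a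
  submodule.
\<close>

lemma half_superderivation_commutes:
  assumes f: "delta_superderivation (1 / 2) k f" and z: "z \<in> G 1"
  shows "supercommutator k z f v = 0"
proof (rule ccontr)
  assume nonzero: "supercommutator k z f v \<noteq> 0"
  obtain x w where x: "x \<in> G 1" and "mul x (mul x (mul x (mul x w))) \<noteq> 0"
    using exists_odd_fourth_power by blast
  moreover have "mul x (mul x (mul x (mul x w))) = 0"
  proof (rule fourth_power_vanishes)
    let ?D = "\<lambda>k p. \<exists>j z f. k = j + 1 \<and> z \<in> G 1 \<and> delta_superderivation (1 / 2) j f
      \<and> p = supercommutator j z f"
    show super: "delta_superderivation (1 / 2) k p" if "?D k p" for k p
      using that supercommutator_superderivation by blast
    show "?D (k + 1) (supercommutator k x p)" if "?D k p" "x \<in> G 1" for k p x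
      using super[OF that(1)] that(2) by blast
    show "?D (k + 1) (supercommutator k z f)"
      using f z by blast
    show "supercommutator k z f v \<noteq> 0"
      by (rule nonzero)
    show "mul x (mul x (mul x (mul x (p v)))) = 0" if "?D k p" for k p v
      using that fourth_power_kills_supercommutator x by blast
  qed
  ultimately show False
    by blast
qed

text \<open>
  The eigenspace is stable under multiplication by odd elements and graded, because \<open>f\<close> preserves
  the degree.
\<close>

lemma half_superderivation_scalar:
  assumes f: "delta_superderivation (1 / 2) 0 f" and w: "f w = scale a w" "w \<noteq> 0"
  shows "f x = scale a x"
proof -
  note lin = delta_superderivation_simps[OF f]
  let ?E = "{x. f x = scale a x}"
  have sub: "subspace ?E"
    by (rule subspaceI) (simp_all add: lin module_simps mult.commute)
  have "graded_ideal ?E"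
  proof (rule graded_ideal_oddI)
    have "component i x \<in> ?E" if "x \<in> ?E" for i x
    proof -
      have grade: "f y \<in> G j" if "y \<in> G j" for y j
        using delta_superderivation_grade[OF f that] by (simp only: add_0)
      have "component i (f x) = f (component i x)"
        by (rule component_eqI) (simp_all only: grade component_props lin(3)[symmetric])
      then show ?thesis
        using that by (simp add: component_linear)
    qed
    then show "graded_subspace ?E"
      unfolding graded_subspace_def using sub component_sum component_props(1) by blast
    fix z y assume z: "z \<in> G 1" and y: "y \<in> ?E"
    have "f (mul z y) = mul z (f y)"
      using half_superderivation_commutes[OF f z, of y]
      by (simp add: supercommutator_def super_sign_simps)
    then show "mul z y \<in> ?E"
      using y by (simp add: mul_simps)
  qed
  then have "?E = UNIV"
    by (rule ideal_full[of _ w]) (use w in simp_all)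
  then show ?thesis
    by blast
qed

end

section \<open>Eigenvectors\<close>

definition apply_poly ::
    "('f::field \<Rightarrow> 'a::ab_group_add \<Rightarrow> 'a) \<Rightarrow> 'f poly \<Rightarrow> ('a \<Rightarrow> 'a) \<Rightarrow> 'a \<Rightarrow> 'a" where
  "apply_poly scale p f v = (\<Sum>i\<le>degree p. scale (coeff p i) ((f ^^ i) v))"

context vector_space
begin

lemma apply_poly_bound:
  fixes p :: "'a poly" and f :: "'b \<Rightarrow> 'b"
  assumes "degree p \<le> n"
  shows "apply_poly scale p f v = (\<Sum>i\<le>n. scale (coeff p i) ((f ^^ i) v))"
  unfolding apply_poly_def
  by (rule sum.mono_neutral_left) (use assms in \<open>auto simp: coeff_eq_0\<close>)

lemma apply_poly_linear_factor:
  fixes q :: "'a poly" and f :: "'b \<Rightarrow> 'b"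
  assumes "Vector_Spaces.linear scale scale f"
  shows "apply_poly scale ([:- a, 1:] * q) f v = f (apply_poly scale q f v) - scale a (apply_poly scale q f v)"
proof -
  interpret f: Vector_Spaces.linear scale scale f
    by (rule assms)
  let ?n = "degree q"
  have "degree ([:- a, 1:] * q) \<le> Suc ?n"
    using degree_mult_le[of "[:- a, 1:]" q] by simp
  then have "apply_poly scale ([:- a, 1:] * q) f v =
      (\<Sum>i\<le>Suc ?n. scale (coeff (pCons 0 q) i) ((f ^^ i) v) - scale a (scale (coeff q i) ((f ^^ i) v)))"
    by (subst apply_poly_bound) (auto simp: scale_left_diff_distrib intro!: sum.cong)
  also have "\<dots> = (\<Sum>i\<le>Suc ?n. scale (coeff (pCons 0 q) i) ((f ^^ i) v))
      - scale a (apply_poly scale q f v)"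
    by (simp add: sum_subtractf scale_sum_right apply_poly_bound[of q "Suc ?n"] del: sum.atMost_Suc)
  also have "(\<Sum>i\<le>Suc ?n. scale (coeff (pCons 0 q) i) ((f ^^ i) v)) = f (apply_poly scale q f v)"
    by (simp add: sum.atMost_Suc_shift apply_poly_def f.sum f.scale del: sum.atMost_Suc)
  finally show ?thesis .
qed

text \<open>
  More iterates \<open>f\<^sup>i v\<close> than the dimension satisfy a linear relation, unless two of them coincide,
  which is a relation as well.
\<close>

lemma annihilating_poly:
  fixes f :: "'b \<Rightarrow> 'b"
  assumes "finite B" "span B = UNIV"
  shows "\<exists>p. p \<noteq> 0 \<and> apply_poly scale p f v = 0"
proof -
  let ?n = "card B" and ?g = "\<lambda>i. (f ^^ i) v"
  have "\<exists>c. (\<exists>i\<le>?n. c i \<noteq> 0) \<and> (\<Sum>i\<le>?n. scale (c i) (?g i)) = 0"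
  proof (cases "inj_on ?g {..?n}")
    case True
    let ?S = "?g ` {..?n}"
    have "card ?S = Suc ?n"
      using True by (simp add: card_image)
    then have "dependent ?S"
      using independent_span_bound[OF assms(1), of ?S] assms(2) by auto
    then obtain u x where u: "x \<in> ?S" "u x \<noteq> 0" "(\<Sum>x\<in>?S. scale (u x) x) = 0"
      using dependent_finite[of ?S] by auto
    then have "(\<Sum>i\<le>?n. scale (u (?g i)) (?g i)) = 0"
      by (simp add: sum.reindex[OF True])
    then show ?thesis
      using u by (intro exI[of _ "\<lambda>i. u (?g i)"]) auto
  next
    case False
    then obtain i j where ij: "i \<le> ?n" "j \<le> ?n" "i \<noteq> j" "?g i = ?g j"
      by (auto simp: inj_on_def)
    let ?c = "\<lambda>k. (if k = i then 1 else 0) - (if k = j then 1 else 0)"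
    have "(\<Sum>k\<le>?n. scale (?c k) (?g k)) =
        (\<Sum>k\<le>?n. if k = i then ?g k else 0) - (\<Sum>k\<le>?n. if k = j then ?g k else 0)"
      unfolding sum_subtractf[symmetric] by (intro sum.cong) (auto simp: scale_left_diff_distrib)
    then have "(\<Sum>k\<le>?n. scale (?c k) (?g k)) = 0"
      using ij by simp
    then show ?thesis
      using ij by (intro exI[of _ ?c]) auto
  qed
  then obtain c i where c: "i \<le> ?n" "c i \<noteq> 0" "(\<Sum>i\<le>?n. scale (c i) (?g i)) = 0"
    by blast
  define p where "p = (\<Sum>i\<le>?n. monom (c i) i)"
  have coeff: "coeff p i = (if i \<le> ?n then c i else 0)" for i
    by (simp add: p_def coeff_sum)
  have "degree p \<le> ?n"
    by (rule degree_le) (simp add: coeff)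
  then have "apply_poly scale p f v = 0"
    using c(3) by (simp add: apply_poly_bound coeff)
  moreover have "p \<noteq> 0"
    using c coeff[of i] by auto
  ultimately show ?thesis
    by blast
qed

end

text \<open>
  Descent on the degree: a linear factor, belonging to a root \<open>a\<close>, of a polynomial that annihilates
  \<open>v\<close> either can be cancelled or exhibits an eigenvector for \<open>a\<close>.
\<close>

lemma eigenvector_exists:
  fixes scale :: "'f::alg_closed_field \<Rightarrow> 'a::ab_group_add \<Rightarrow> 'a" and v :: 'a
  assumes "vector_space scale" and lin: "Vector_Spaces.linear scale scale f"
    and fin: "finite B" "module.span scale B = UNIV" and v: "v \<noteq> 0"
  shows "\<exists>a w. w \<noteq> 0 \<and> f w = scale a w"
proof -
  interpret vector_space scale
    by fact
  have "\<exists>a w. w \<noteq> 0 \<and> f w = scale a w" if "p \<noteq> 0" "apply_poly scale p f v = 0" for p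
    using that
  proof (induction "degree p" arbitrary: p)
    case 0
    then obtain c where "p = [:c:]"
      by (metis degree_eq_zeroE)
    then show ?case
      using 0 v by (simp add: apply_poly_def scale_eq_0_iff)
  next
    case (Suc n)
    then obtain a where "poly p a = 0"
      using alg_closed_imp_poly_has_root[of p] by auto
    then obtain q where q: "p = [:- a, 1:] * q"
      using poly_eq_0_iff_dvd by (metis dvdE)
    then have "q \<noteq> 0"
      using Suc.prems by auto
    then have "degree p = Suc (degree q)"
      unfolding q by (subst degree_mult_eq) auto
    then have "n = degree q"
      using Suc.hyps by simp
    show ?case
    proof (cases "apply_poly scale q f v = 0")
      case True
      then show ?thesis
        using Suc.hyps(1) \<open>n = degree q\<close> \<open>q \<noteq> 0\<close> by blast
    next
      case False
      moreover have "f (apply_poly scale q f v) - scale a (apply_poly scale q f v) = 0"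
        using Suc.prems(2) unfolding q apply_poly_linear_factor[OF lin] .
      ultimately show ?thesis
        by (intro exI[of _ a] exI[of _ "apply_poly scale q f v"]) simp
    qed
  qed
  then show ?thesis
    using annihilating_poly[OF fin, of f v] by blast
qed

section \<open>Classical Lie superalgebras\<close>

theorem theorem22:
  fixes scale :: "'f::{alg_closed_field, field_char_0} \<Rightarrow> 'a::ab_group_add \<Rightarrow> 'a"
    and G :: "bit \<Rightarrow> 'a set"
    and mul :: "'a \<Rightarrow> 'a \<Rightarrow> 'a"
    and \<delta> :: 'f
    and \<phi> :: "'a \<Rightarrow> 'a"
  assumes "classical_lie_superalgebra scale G mul"
    and "nontrivial_delta_derivation scale mul \<delta> \<phi>"
  shows "\<delta> = 1 / 2 \<and> (\<exists>\<alpha>. \<forall>x. \<phi> x = scale \<alpha> x)"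
proof -
  interpret classical_lie_superalgebra scale G mul
    by (rule assms)
  interpret simple_lie_superalgebra scale G mul
    by unfold_locales (fact finite_dimensional odd_part_nonzero is_simple)+
  have der: "delta_derivation scale mul \<delta> \<phi>" and nonzero: "\<phi> \<noteq> (\<lambda>x. 0)"
    and "\<delta> \<noteq> 0" "\<delta> \<noteq> 1"
    using assms(2) unfolding nontrivial_delta_derivation_def by auto
  then have super: "delta_superderivation \<delta> 0 \<phi>"
    using delta_derivation_is_superderivation completely_reducible by blast
  have half: "\<delta> = 1 / 2"
    using delta_superderivation_zero[OF super \<open>\<delta> \<noteq> 0\<close> \<open>\<delta> \<noteq> 1\<close>] nonzero by blast
  obtain v where "v \<in> G 1" "v \<noteq> 0"
    by (rule obtain_odd)
  moreover have "Vector_Spaces.linear scale scale \<phi>"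
    using der unfolding delta_derivation_def by blast
  moreover obtain B where "finite B" "span B = UNIV"
    using finite_dimensional by blast
  ultimately obtain a w where "w \<noteq> 0" "\<phi> w = scale a w"
    using eigenvector_exists[OF vector_space_axioms] by metis
  then have "\<phi> x = scale a x" for x
    using half_superderivation_scalar super unfolding half by blast
  then show ?thesis
    using half by blast
qed

end
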